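(* Fix $\alpha\in(0,1)$. For each $n$, let $P_1,\dots,P_n$ be independent $[0,1]$-valued P-values with set of true nulls $\mathcal{I}_0\subset\{1,\dots,n\}$, $n_0=\#\mathcal{I}_0$, $n_1=n-n_0$. Assume that $n_0/n\to\pi_0\in(0,1)$ as $n\to\infty$, and that there is a continuous distribution function $G$ on the real line such that, for any fixed $0\le s<t\le 1$, almost surely, $$\lim_{n\to\infty}\frac{V(s,t)}{n_0}=t-s,\qquad \lim_{n\to\infty}\frac{S(s,t)}{n_1}=G(t)-G(s).$$ Assume that $G$ is differentiable (on $[0,1]$). Let $\delta$ and $\mathcal{A}$ be the value and the set of maximizers of the problem of maximizing $t-s$ subject to $\overline{\mathrm{FDR}}^\infty(s,t)\le\alpha$, and let $\delta_\diamond=\max\{t:\overline{\mathrm{FDR}}^\infty(0,t)\le\alpha\}$. Assume that $\delta>0$ and that there is $(s,t)\in\mathcal{A}$ such that $u\mapsto\overline{\mathrm{FDR}}^\infty(u,t)$ is strictly decreasing at $u=s$ or $u\mapsto\overline{\mathrm{FDR}}^\infty(s,u)$ is strictly increasing at $u=t$. Assume in addition that $$G'(0)<G'(\delta_\diamond).$$ Then the scan procedure at level $\alpha$ has strictly smaller asymptotic false non-discovery rate than the Benjamini–Hochberg (BH) procedure at level $\alpha$, that is, $$\lim_{n\to\infty}\mathbb{E}\big[\mathrm{FNP}(\hat\sigma_n,\hat\tau_n)\big]<\lim_{n\to\infty}\mathbb{E}\big[\mathrm{FNP}(0,\hat\tau_{\diamond,n})\big].$$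
   Context: For $0\le s\le t\le 1$ (dependence on $n$ implicit): $V(s,t)=\#\{i\in\mathcal{I}_0: s\le P_i\le t\}$, $S(s,t)=\#\{i\notin\mathcal{I}_0: s\le P_i\le t\}$, $R(s,t)=V(s,t)+S(s,t)$, and $\widehat{\mathrm{FDR}}(s,t)=\frac{n(t-s)}{R(s,t)\vee 1}$, where $a\vee b=\max(a,b)$. Scan procedure at level $\alpha$: reject the null hypotheses with P-values in $[\hat\sigma_n,\hat\tau_n]$, where $(\hat\sigma_n,\hat\tau_n)$ is a maximizer of $t-s$ over all $0\le s\le t\le1$ with $\widehat{\mathrm{FDR}}(s,t)\le\alpha$ (the left-most maximizing interval if there are several). BH procedure at level $\alpha$: reject the null hypotheses with P-values in $[0,\hat\tau_{\diamond,n}]$, where $\hat\tau_{\diamond,n}=\max\{t\in[0,1]:\widehat{\mathrm{FDR}}(0,t)\le\alpha\}$. The false non-discovery proportion of a procedure is the number of false nulls not rejected divided by $n_1$; for rejection region $[s,t]$ it is $\mathrm{FNP}(s,t)=1-S(s,t)/n_1$. The false non-discovery rate (FNR) is its expectation, and the asymptotic FNR is the limit of the FNR as $n\to\infty$. With $\pi_1=1-\pi_0$, for $0\le s<t\le 1$, $$\overline{\mathrm{FDR}}^\infty(s,t)=\frac{t-s}{\pi_0(t-s)+\pi_1(G(t)-G(s))}.$$ With $\beta=\frac{1}{\pi_1}\left(\frac1\alpha-\pi_0\right)$: $\delta=\max\{t-s:\overline{\mathrm{FDR}}^\infty(s,t)\le\alpha\}$, or equivalently $\delta=\max\{t-s: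 G(t)-G(s)=\beta(t-s)\}$; $\mathcal{A}$ is the set of $(s,t)$, $0\le s\le t\le 1$, attaining this maximum; $\delta_\diamond$ may also be defined as the right-most solution $t\in[0,1]$ of $G(t)=\beta t$. $G'(0)$ is the (right) derivative of $G$ at $0$. "Strictly decreasing at $u=s$" means: there is $\varepsilon>0$ with $\overline{\mathrm{FDR}}^\infty(u,t)<\overline{\mathrm{FDR}}^\infty(s,t)$ for $s<u\le s+\varepsilon$. "Strictly increasing at $u=t$" means: there is $\varepsilon>0$ with $\overline{\mathrm{FDR}}^\infty(s,u)<\overline{\mathrm{FDR}}^\infty(s,t)$ for $t-\varepsilon\le u<t$.
   Formalization: The BH limit can fail to exist when FDR^∞(0,·) only touches α at δ_⋄; so the strict inequality is proved whenever that limit exists, with liminf of the BH rate in all cases, and the limit is proved to exist if δ_⋄ is in the closure of {t>0: FDR^∞(0,t)<α}. *)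

theory Defs
  imports "HOL-Probability.Probability"
begin

text \<open>
  Throughout, \<open>p\<close> is one realised vector of P-values \<open>p 1, \<dots>, p n\<close> and \<open>I\<close>, a subset of
  \<open>{1..n}\<close>, is the set of true nulls.
\<close>

definition V_count :: "nat set \<Rightarrow> (nat \<Rightarrow> real) \<Rightarrow> real \<Rightarrow> real \<Rightarrow> nat" where
  "V_count I p s t = card {i \<in> I. s \<le> p i \<and> p i \<le> t}"

definition S_count :: "nat \<Rightarrow> nat set \<Rightarrow> (nat \<Rightarrow> real) \<Rightarrow> real \<Rightarrow> real \<Rightarrow> nat" where
  "S_count n I p s t = card {i \<in> {1..n} - I. s \<le> p i \<and> p i \<le> t}"

definition R_count :: "nat \<Rightarrow> nat set \<Rightarrow> (nat \<Rightarrow> real) \<Rightarrow> real \<Rightarrow> real \<Rightarrow> nat" where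
  "R_count n I p s t = V_count I p s t + S_count n I p s t"

text \<open>Both procedures depend on the data only, not on which nulls are true:\<close>

lemma R_count_eq_card:
  assumes "I \<subseteq> {1..n}"
  shows "R_count n I p s t = card {i \<in> {1..n}. s \<le> p i \<and> p i \<le> t}"
proof -
  have fin: "finite I"
    using assms finite_subset by blast
  have "{i \<in> {1..n}. s \<le> p i \<and> p i \<le> t} =
      {i \<in> I. s \<le> p i \<and> p i \<le> t} \<union> {i \<in> {1..n} - I. s \<le> p i \<and> p i \<le> t}"
    using assms by auto
  then show ?thesis
    unfolding R_count_def V_count_def S_count_def
    using fin by (subst card_Un_disjoint[symmetric]) auto
qed

definition FDR_hat :: "nat \<Rightarrow> nat set \<Rightarrow> (nat \<Rightarrow> real) \<Rightarrow> real \<Rightarrow> real \<Rightarrow> real" where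
  "FDR_hat n I p s t = real n * (t - s) / real (max (R_count n I p s t) 1)"

definition FNP :: "nat \<Rightarrow> nat set \<Rightarrow> (nat \<Rightarrow> real) \<Rightarrow> real \<Rightarrow> real \<Rightarrow> real" where
  "FNP n I p s t = 1 - real (S_count n I p s t) / (real n - real (card I))"

definition scan_feasible :: "real \<Rightarrow> nat \<Rightarrow> nat set \<Rightarrow> (nat \<Rightarrow> real) \<Rightarrow> (real \<times> real) set" where
  "scan_feasible \<alpha> n I p = {(s, t). 0 \<le> s \<and> s \<le> t \<and> t \<le> 1 \<and> FDR_hat n I p s t \<le> \<alpha>}"

definition scan_maximizers :: "real \<Rightarrow> nat \<Rightarrow> nat set \<Rightarrow> (nat \<Rightarrow> real) \<Rightarrow> (real \<times> real) set" where
  "scan_maximizers \<alpha> n I p =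
     {x. is_arg_max (\<lambda>(s, t). t - s) (\<lambda>y. y \<in> scan_feasible \<alpha> n I p) x}"

text \<open>
  The counts are upper semicontinuous in \<open>(s, t)\<close>, because the intervals are closed, so for
  \<open>\<alpha> \<ge> 0\<close> the feasible set is compact, and it contains \<open>(0, 0)\<close>.  Hence maximizers exist, their
  set is compact, and the left-most one exists; it is unique because all maximizers have the
  same length.
\<close>

definition scan_interval :: "real \<Rightarrow> nat \<Rightarrow> nat set \<Rightarrow> (nat \<Rightarrow> real) \<Rightarrow> real \<times> real" where
  "scan_interval \<alpha> n I p =
     (THE x. x \<in> scan_maximizers \<alpha> n I p \<and> (\<forall>y \<in> scan_maximizers \<alpha> n I p. fst x \<le> fst y))"

definition BH_threshold :: "real \<Rightarrow> nat \<Rightarrow> nat set \<Rightarrow> (nat \<Rightarrow> real) \<Rightarrow> real" where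
  "BH_threshold \<alpha> n I p = (GREATEST t. 0 \<le> t \<and> t \<le> 1 \<and> FDR_hat n I p 0 t \<le> \<alpha>)"

definition scan_FNR ::
    "'a measure \<Rightarrow> real \<Rightarrow> (nat \<Rightarrow> nat set) \<Rightarrow> (nat \<Rightarrow> nat \<Rightarrow> 'a \<Rightarrow> real) \<Rightarrow> nat \<Rightarrow> real" where
  "scan_FNR M \<alpha> I\<^sub>0 P n =
     (\<integral>\<omega>. (let p = (\<lambda>i. P n i \<omega>); (s, t) = scan_interval \<alpha> n (I\<^sub>0 n) p
           in FNP n (I\<^sub>0 n) p s t) \<partial>M)"

definition BH_FNR ::
    "'a measure \<Rightarrow> real \<Rightarrow> (nat \<Rightarrow> nat set) \<Rightarrow> (nat \<Rightarrow> nat \<Rightarrow> 'a \<Rightarrow> real) \<Rightarrow> nat \<Rightarrow> real" where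
  "BH_FNR M \<alpha> I\<^sub>0 P n =
     (\<integral>\<omega>. (let p = (\<lambda>i. P n i \<omega>)
           in FNP n (I\<^sub>0 n) p 0 (BH_threshold \<alpha> n (I\<^sub>0 n) p)) \<partial>M)"

text \<open>
  For \<open>s = t\<close> the quotient below is \<open>0 / 0 = 0\<close>, so degenerate intervals are feasible at every
  level \<open>\<alpha> \<ge> 0\<close>.  This is in accordance with the description of feasibility by
  \<open>G t - G s \<ge> \<beta> * (t - s)\<close>, \<open>\<beta> = (1/\<alpha> - \<pi>\<^sub>0) / (1 - \<pi>\<^sub>0)\<close>, which holds trivially for \<open>s = t\<close>.
\<close>

definition FDR_inf :: "real \<Rightarrow> (real \<Rightarrow> real) \<Rightarrow> real \<Rightarrow> real \<Rightarrow> real" where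
  "FDR_inf \<pi>\<^sub>0 G s t = (t - s) / (\<pi>\<^sub>0 * (t - s) + (1 - \<pi>\<^sub>0) * (G t - G s))"

definition opt_feasible :: "real \<Rightarrow> real \<Rightarrow> (real \<Rightarrow> real) \<Rightarrow> (real \<times> real) set" where
  "opt_feasible \<alpha> \<pi>\<^sub>0 G = {(s, t). 0 \<le> s \<and> s \<le> t \<and> t \<le> 1 \<and> FDR_inf \<pi>\<^sub>0 G s t \<le> \<alpha>}"

definition opt_width :: "real \<Rightarrow> real \<Rightarrow> (real \<Rightarrow> real) \<Rightarrow> real" where
  "opt_width \<alpha> \<pi>\<^sub>0 G = (GREATEST w. \<exists>(s, t) \<in> opt_feasible \<alpha> \<pi>\<^sub>0 G. w = t - s)"

definition opt_intervals :: "real \<Rightarrow> real \<Rightarrow> (real \<Rightarrow> real) \<Rightarrow> (real \<times> real) set" where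
  "opt_intervals \<alpha> \<pi>\<^sub>0 G = {(s, t) \<in> opt_feasible \<alpha> \<pi>\<^sub>0 G. t - s = opt_width \<alpha> \<pi>\<^sub>0 G}"

definition BH_limit :: "real \<Rightarrow> real \<Rightarrow> (real \<Rightarrow> real) \<Rightarrow> real" where
  "BH_limit \<alpha> \<pi>\<^sub>0 G = (GREATEST t. 0 \<le> t \<and> t \<le> 1 \<and> FDR_inf \<pi>\<^sub>0 G 0 t \<le> \<alpha>)"

text \<open>One-sided notions: decrease immediately to the right, increase immediately to the left.\<close>

definition strictly_decreasing_at :: "(real \<Rightarrow> real) \<Rightarrow> real \<Rightarrow> bool" where
  "strictly_decreasing_at f s \<longleftrightarrow> (\<exists>\<epsilon>>0. \<forall>u. s < u \<and> u \<le> s + \<epsilon> \<longrightarrow> f u < f s)"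

definition strictly_increasing_at :: "(real \<Rightarrow> real) \<Rightarrow> real \<Rightarrow> bool" where
  "strictly_increasing_at f t \<longleftrightarrow> (\<exists>\<epsilon>>0. \<forall>u. t - \<epsilon> \<le> u \<and> u < t \<longrightarrow> f u < f t)"

end

theory Submission
  imports Defs
begin

text \<open>
Let \<open>\<beta> = (1/\<alpha> - \<pi>\<^sub>0) / (1 - \<pi>\<^sub>0)\<close>, which exceeds \<open>1\<close>.  In the limit \<open>n \<rightarrow> \<infinity>\<close> an interval
\<open>[s, t]\<close> is feasible iff its excess \<open>G t - G s - \<beta> * (t - s)\<close> is nonnegative.  Both procedures reject
on the left-most longest feasible interval, the scan procedure among all intervals and BH among
those with left endpoint \<open>0\<close>.  They are therefore treated together, as the same rule with a
cutoff \<open>a\<close> on the left endpoint.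

Such a rule wastes nothing: a selected interval has width exactly \<open>\<alpha> * max R 1 / n\<close>
(\<open>leftmost_longest_width\<close>).  Since the empirical counts converge uniformly over intervals
(\<open>uniform_interval_convergence\<close>), its excess tends to \<open>0\<close>, which says that the fraction of false
nulls rejected is asymptotically \<open>\<beta>\<close> times the width (\<open>power_approximation\<close>).  So the procedures
are compared by comparing widths.  By compactness the width asymptotically does not exceed
the greatest feasible width of the limit problem (\<open>width_eventually_less\<close>), and it reaches it if
there are strictly feasible intervals of almost that width (\<open>width_eventually_ge\<close>).  The latter
holds for the scan procedure by the monotonicity assumption at an optimal interval.  For BH it is a
condition at \<open>BH_limit\<close>; without it there is still the lower bound \<open>1 - \<beta> * BH_limit\<close> for the lower
limit of the FNR.  Almost sure convergence passes to expectations by dominated convergence.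

What remains is \<open>BH_limit < opt_width\<close> (\<open>BH_limit_less_opt_width\<close>).  The interval
\<open>[0, BH_limit]\<close> is feasible, and because \<open>G'\<close> is smaller at its left end than at its right end,
shifting it slightly to the right gains excess, which can be spent on making it longer.
\<close>

section \<open>Intervals feasible in the limit\<close>

text \<open>
Clearing denominators in \<open>FDR_inf \<pi>\<^sub>0 G s t \<le> \<alpha>\<close> gives the slope \<open>\<beta>\<close> that \<open>G\<close> must have on average
over \<open>[s, t]\<close>.
\<close>

definition critical_slope :: "real \<Rightarrow> real \<Rightarrow> real" where
  "critical_slope \<alpha> \<pi>\<^sub>0 = (1 / \<alpha> - \<pi>\<^sub>0) / (1 - \<pi>\<^sub>0)"

lemma critical_slope_gt_1:
  assumes "0 < \<alpha>" "\<alpha> < 1" "\<pi>\<^sub>0 < 1"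
  shows "1 < critical_slope \<alpha> \<pi>\<^sub>0"
proof -
  have "1 < 1 / \<alpha>"
    using assms by simp
  then show ?thesis
    unfolding critical_slope_def using assms by (simp add: less_divide_eq)
qed

text \<open>
With \<open>w\<close> the width and \<open>d\<close> the increment of \<open>G\<close>, the left-hand side is the limiting fraction of
rejections minus the fraction that level \<open>\<alpha>\<close> demands.  This identity turns every statement
about rejections into one about the excess \<open>d - \<beta> * w\<close> of \<open>G\<close> over the critical line.
\<close>

lemma critical_slope_gap:
  assumes "\<pi>\<^sub>0 < 1"
  shows "\<pi>\<^sub>0 * w + (1 - \<pi>\<^sub>0) * d - w / \<alpha> = (1 - \<pi>\<^sub>0) * (d - critical_slope \<alpha> \<pi>\<^sub>0 * w)"
proof -
  have "(1 - \<pi>\<^sub>0) * critical_slope \<alpha> \<pi>\<^sub>0 = 1 / \<alpha> - \<pi>\<^sub>0"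
    unfolding critical_slope_def using assms by simp
  then have "(1 - \<pi>\<^sub>0) * (d - critical_slope \<alpha> \<pi>\<^sub>0 * w) = (1 - \<pi>\<^sub>0) * d - (1 / \<alpha> - \<pi>\<^sub>0) * w"
    by (metis mult.assoc right_diff_distrib)
  then show ?thesis
    by (simp add: algebra_simps)
qed

lemma FDR_inf_level_iff:
  assumes "0 < \<alpha>" "0 < \<pi>\<^sub>0" "\<pi>\<^sub>0 < 1" "mono G" "s < t"
  shows "FDR_inf \<pi>\<^sub>0 G s t \<le> \<alpha> \<longleftrightarrow> critical_slope \<alpha> \<pi>\<^sub>0 * (t - s) \<le> G t - G s"
    and "FDR_inf \<pi>\<^sub>0 G s t < \<alpha> \<longleftrightarrow> critical_slope \<alpha> \<pi>\<^sub>0 * (t - s) < G t - G s"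
proof -
  let ?L = "\<pi>\<^sub>0 * (t - s) + (1 - \<pi>\<^sub>0) * (G t - G s)"
  have "0 \<le> (1 - \<pi>\<^sub>0) * (G t - G s)"
    using assms monoD[OF \<open>mono G\<close>, of s t] by (intro mult_nonneg_nonneg) auto
  moreover have "0 < \<pi>\<^sub>0 * (t - s)"
    using assms by simp
  ultimately have L: "0 < ?L" by linarith
  have gap: "?L - (t - s) / \<alpha> = (1 - \<pi>\<^sub>0) * (G t - G s - critical_slope \<alpha> \<pi>\<^sub>0 * (t - s))"
    by (rule critical_slope_gap) fact
  have "FDR_inf \<pi>\<^sub>0 G s t \<le> \<alpha> \<longleftrightarrow> 0 \<le> ?L - (t - s) / \<alpha>"
    unfolding FDR_inf_def using L assms by (simp add: divide_le_eq mult.commute)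
  then show "FDR_inf \<pi>\<^sub>0 G s t \<le> \<alpha> \<longleftrightarrow> critical_slope \<alpha> \<pi>\<^sub>0 * (t - s) \<le> G t - G s"
    unfolding gap using assms by (simp add: zero_le_mult_iff)
  have "FDR_inf \<pi>\<^sub>0 G s t < \<alpha> \<longleftrightarrow> 0 < ?L - (t - s) / \<alpha>"
    unfolding FDR_inf_def using L assms by (simp add: divide_less_eq mult.commute)
  then show "FDR_inf \<pi>\<^sub>0 G s t < \<alpha> \<longleftrightarrow> critical_slope \<alpha> \<pi>\<^sub>0 * (t - s) < G t - G s"
    unfolding gap using assms by (simp add: zero_less_mult_iff)
qed

lemma FDR_inf_le_iff:
  assumes "0 < \<alpha>" "0 < \<pi>\<^sub>0" "\<pi>\<^sub>0 < 1" "mono G" "s \<le> t"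
  shows "FDR_inf \<pi>\<^sub>0 G s t \<le> \<alpha> \<longleftrightarrow> critical_slope \<alpha> \<pi>\<^sub>0 * (t - s) \<le> G t - G s"
proof (cases "s = t")
  case True
  then show ?thesis
    using assms by (simp add: FDR_inf_def)
next
  case False
  then show ?thesis
    using assms by (intro FDR_inf_level_iff) auto
qed

text \<open>
The cutoff \<open>a\<close> on the left endpoint treats both procedures at once: for \<open>a = 1\<close> all intervals
compete, as in the scan procedure, and for \<open>a = 0\<close> only the intervals \<open>[0, t]\<close>, as in BH.
\<close>

definition intervals_from :: "real \<Rightarrow> (real \<times> real) set" where
  "intervals_from a = {(s, t). 0 \<le> s \<and> s \<le> a \<and> s \<le> t \<and> t \<le> 1}"

lemma compact_intervals_from: "compact (intervals_from a)"
proof -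
  have "intervals_from a = ({0..1} \<times> {0..1}) \<inter> {x. fst x \<le> a} \<inter> {x. fst x \<le> snd x}"
    unfolding intervals_from_def by auto
  moreover have "closed {x :: real \<times> real. fst x \<le> a}" "closed {x :: real \<times> real. fst x \<le> snd x}"
    by (auto intro!: closed_Collect_le continuous_intros)
  ultimately show ?thesis
    by (auto intro!: compact_Int_closed compact_Times)
qed

text \<open>
The feasible intervals form a compact set, as \<open>G\<close> is continuous, and \<open>[0, 0]\<close> is one of them.
\<close>

lemma longest_interval_exists:
  fixes G :: "real \<Rightarrow> real"
  assumes "continuous_on UNIV G" "0 \<le> a"
  shows "\<exists>x \<in> intervals_from a. b * (snd x - fst x) \<le> G (snd x) - G (fst x) \<and>
    (\<forall>y \<in> intervals_from a. b * (snd y - fst y) \<le> G (snd y) - G (fst y)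
       \<longrightarrow> snd y - fst y \<le> snd x - fst x)"
proof -
  let ?F = "{x. b * (snd x - fst x) \<le> G (snd x) - G (fst x)}"
  have "continuous_on UNIV (\<lambda>x :: real \<times> real. G (fst x))"
    "continuous_on UNIV (\<lambda>x :: real \<times> real. G (snd x))"
    by (intro continuous_on_compose2[OF assms(1)] continuous_intros; simp)+
  then have "closed ?F"
    by (intro closed_Collect_le continuous_intros)
  then have comp: "compact (intervals_from a \<inter> ?F)"
    using compact_intervals_from by blast
  moreover have "(0, 0) \<in> intervals_from a \<inter> ?F"
    using assms(2) by (simp add: intervals_from_def)
  ultimately have "\<exists>x \<in> intervals_from a \<inter> ?F. \<forall>y \<in> intervals_from a \<inter> ?F.
      snd y - fst y \<le> snd x - fst x"
    by (intro continuous_attains_sup continuous_intros) auto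
  then show ?thesis
    by fast
qed

lemma opt_feasible_iff:
  assumes "0 < \<alpha>" "0 < \<pi>\<^sub>0" "\<pi>\<^sub>0 < 1" "mono G"
  shows "x \<in> opt_feasible \<alpha> \<pi>\<^sub>0 G \<longleftrightarrow>
    x \<in> intervals_from 1 \<and> critical_slope \<alpha> \<pi>\<^sub>0 * (snd x - fst x) \<le> G (snd x) - G (fst x)"
  using FDR_inf_le_iff[OF assms]
  by (cases x) (auto simp: opt_feasible_def intervals_from_def)

text \<open>
\<open>opt_width\<close> selects a greatest width without saying that there is one; existence comes from
compactness.
\<close>

lemma width_le_opt_width:
  assumes "0 < \<alpha>" "0 < \<pi>\<^sub>0" "\<pi>\<^sub>0 < 1" "mono G" "continuous_on UNIV G"
    and "x \<in> intervals_from 1"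
    and "critical_slope \<alpha> \<pi>\<^sub>0 * (snd x - fst x) \<le> G (snd x) - G (fst x)"
  shows "snd x - fst x \<le> opt_width \<alpha> \<pi>\<^sub>0 G"
proof -
  obtain z where z: "z \<in> opt_feasible \<alpha> \<pi>\<^sub>0 G"
    "\<And>y. y \<in> opt_feasible \<alpha> \<pi>\<^sub>0 G \<Longrightarrow> snd y - fst y \<le> snd z - fst z"
    using longest_interval_exists[OF assms(5), of 1 "critical_slope \<alpha> \<pi>\<^sub>0"]
    unfolding opt_feasible_iff[OF assms(1-4)] by auto
  have "opt_width \<alpha> \<pi>\<^sub>0 G = snd z - fst z"
    unfolding opt_width_def
    by (rule Greatest_equality) (use z in \<open>force+\<close>)
  then show ?thesis
    using z(2) assms(6,7) opt_feasible_iff[OF assms(1-4)] by simp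
qed

lemma BH_limit_greatest:
  assumes "0 < \<alpha>" "0 < \<pi>\<^sub>0" "\<pi>\<^sub>0 < 1" "mono G" "continuous_on UNIV G"
  shows "0 \<le> BH_limit \<alpha> \<pi>\<^sub>0 G" "BH_limit \<alpha> \<pi>\<^sub>0 G \<le> 1"
    and "critical_slope \<alpha> \<pi>\<^sub>0 * BH_limit \<alpha> \<pi>\<^sub>0 G \<le> G (BH_limit \<alpha> \<pi>\<^sub>0 G) - G 0"
    and "\<And>t. \<lbrakk>0 \<le> t; t \<le> 1; critical_slope \<alpha> \<pi>\<^sub>0 * t \<le> G t - G 0\<rbrakk> \<Longrightarrow> t \<le> BH_limit \<alpha> \<pi>\<^sub>0 G"
proof -
  let ?b = "critical_slope \<alpha> \<pi>\<^sub>0"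
  obtain x where x: "x \<in> intervals_from 0" "?b * (snd x - fst x) \<le> G (snd x) - G (fst x)"
    "\<And>y. y \<in> intervals_from 0 \<Longrightarrow> ?b * (snd y - fst y) \<le> G (snd y) - G (fst y)
       \<Longrightarrow> snd y - fst y \<le> snd x - fst x"
    using longest_interval_exists[OF assms(5), of 0 ?b] by auto
  define z where "z = snd x"
  have "fst x = 0" "0 \<le> z" "z \<le> 1"
    using x(1) unfolding z_def intervals_from_def by auto
  moreover have "y \<le> z" if "0 \<le> y" "y \<le> 1" "?b * y \<le> G y - G 0" for y
    using x(3)[of "(0, y)"] that \<open>fst x = 0\<close> unfolding z_def by (simp add: intervals_from_def)
  ultimately have z: "0 \<le> z" "z \<le> 1" "?b * z \<le> G z - G 0"
    "\<And>y. 0 \<le> y \<Longrightarrow> y \<le> 1 \<Longrightarrow> ?b * y \<le> G y - G 0 \<Longrightarrow> y \<le> z"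
    using x(2) unfolding z_def by auto
  have iff: "FDR_inf \<pi>\<^sub>0 G 0 t \<le> \<alpha> \<longleftrightarrow> ?b * t \<le> G t - G 0" if "0 \<le> t" for t
    using FDR_inf_le_iff[OF assms(1-4) that] by simp
  have "BH_limit \<alpha> \<pi>\<^sub>0 G = z"
    unfolding BH_limit_def by (rule Greatest_equality) (use z iff in auto)
  then show "0 \<le> BH_limit \<alpha> \<pi>\<^sub>0 G" "BH_limit \<alpha> \<pi>\<^sub>0 G \<le> 1"
    "?b * BH_limit \<alpha> \<pi>\<^sub>0 G \<le> G (BH_limit \<alpha> \<pi>\<^sub>0 G) - G 0"
    "\<And>t. \<lbrakk>0 \<le> t; t \<le> 1; ?b * t \<le> G t - G 0\<rbrakk> \<Longrightarrow> t \<le> BH_limit \<alpha> \<pi>\<^sub>0 G"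
    using z by auto
qed

text \<open>
To first order, moving \<open>[0, c]\<close> to the right by \<open>h\<close> adds \<open>d\<^sub>1 * h\<close> to the increment of \<open>G\<close> at the
right end and takes away \<open>d\<^sub>0 * h\<close> at the left end.
\<close>

lemma shifted_increment_larger:
  fixes G :: "real \<Rightarrow> real"
  assumes G0: "(G has_real_derivative d\<^sub>0) (at 0 within {0..1})"
    and Gc: "(G has_real_derivative d\<^sub>1) (at c within {0..1})"
    and c: "0 \<le> c" "c < 1" and "d\<^sub>0 < d\<^sub>1"
  shows "\<exists>h>0. c + h < 1 \<and> G c - G 0 < G (c + h) - G h"
proof -
  have q0: "((\<lambda>h. (G h - G 0) / h) \<longlongrightarrow> d\<^sub>0) (at_right 0)"
  proof -
    have "((\<lambda>h. (G h - G 0) / h) \<longlongrightarrow> d\<^sub>0) (at 0 within {0..1})"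
      using G0 by (simp add: has_field_derivative_iff)
    moreover have "at 0 within {0..1 :: real} = at_right 0"
      by (rule at_within_Icc_at_right) simp
    ultimately show ?thesis by simp
  qed
  have q1: "((\<lambda>h. (G (c + h) - G c) / h) \<longlongrightarrow> d\<^sub>1) (at_right 0)"
  proof -
    have "(G has_real_derivative d\<^sub>1) (at c within {c..1})"
      using Gc by (rule has_field_derivative_subset) (use c in auto)
    then have "((\<lambda>y. (G y - G c) / (y - c)) \<longlongrightarrow> d\<^sub>1) (at c within {c..1})"
      by (simp add: has_field_derivative_iff)
    moreover have "at c within {c..1 :: real} = at_right c"
      by (rule at_within_Icc_at_right) (use c in simp)
    ultimately have "((\<lambda>y. (G y - G c) / (y - c)) \<longlongrightarrow> d\<^sub>1) (at_right c)"
      by simp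
    then show ?thesis
      by (subst (asm) filterlim_at_right_to_0) (simp add: add.commute)
  qed
  have "((\<lambda>h. (G (c + h) - G c) / h - (G h - G 0) / h) \<longlongrightarrow> d\<^sub>1 - d\<^sub>0) (at_right 0)"
    by (intro tendsto_diff q0 q1)
  then have "\<forall>\<^sub>F h in at_right 0. 0 < (G (c + h) - G c) / h - (G h - G 0) / h"
    by (rule order_tendstoD) (use assms in simp)
  moreover have "\<forall>\<^sub>F h in at_right 0. h < 1 - c"
    by (rule eventually_at_rightI[of 0 "1 - c"]) (use c in auto)
  moreover have "\<forall>\<^sub>F h :: real in at_right 0. 0 < h"
    by (rule eventually_at_right_less)
  ultimately have "\<forall>\<^sub>F h in at_right 0. 0 < h \<and> c + h < 1 \<and> G c - G 0 < G (c + h) - G h"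
    by eventually_elim (auto simp: diff_divide_distrib[symmetric] zero_less_divide_iff)
  then show ?thesis
    using eventually_happens'[OF trivial_limit_at_right_real] by blast
qed

text \<open>
This is where the hypothesis on \<open>G'\<close> enters.  A small shift of the interval \<open>[0, BH_limit]\<close> to the
right keeps its width and makes it feasible with room to spare, by
\<open>shifted_increment_larger\<close>; the spare room allows it to be prolonged.  There is space for the
shift because \<open>[0, 1]\<close> itself is infeasible: the average slope of \<open>G\<close> on it is at most \<open>1 < \<beta>\<close>.
\<close>

lemma BH_limit_less_opt_width:
  assumes \<alpha>: "0 < \<alpha>" "\<alpha> < 1" and \<pi>: "0 < \<pi>\<^sub>0" "\<pi>\<^sub>0 < 1"
    and G: "mono G" "continuous_on UNIV G" "G 1 - G 0 \<le> 1"
    and deriv: "\<And>x. x \<in> {0..1} \<Longrightarrow> (G has_real_derivative G' x) (at x within {0..1})"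
    and less: "G' 0 < G' (BH_limit \<alpha> \<pi>\<^sub>0 G)"
  shows "BH_limit \<alpha> \<pi>\<^sub>0 G < opt_width \<alpha> \<pi>\<^sub>0 G"
proof -
  let ?b = "critical_slope \<alpha> \<pi>\<^sub>0" and ?c = "BH_limit \<alpha> \<pi>\<^sub>0 G"
  note BH = BH_limit_greatest[OF \<alpha>(1) \<pi> G(1,2)]
  have "?c \<noteq> 1"
    using BH(3) critical_slope_gt_1[OF \<alpha> \<pi>(2)] G(3) by auto
  then have c: "0 \<le> ?c" "?c < 1"
    using BH(1,2) by auto
  obtain h where h: "0 < h" "?c + h < 1" "G ?c - G 0 < G (?c + h) - G h"
    using shifted_increment_larger[OF deriv deriv c less] c by auto
  \<comment> \<open>The shifted interval \<open>[h, ?c + h]\<close> has positive excess, so by continuity slightly longer ones do.\<close>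
  have "((\<lambda>t. G t - G h - ?b * (t - h)) \<longlongrightarrow> G (?c + h) - G h - ?b * (?c + h - h)) (at_right (?c + h))"
    using G(2) by (intro tendsto_intros) (auto simp: continuous_on_def intro: tendsto_within_subset)
  moreover have "0 < G (?c + h) - G h - ?b * (?c + h - h)"
    using h(3) BH(3) by simp
  ultimately have "\<forall>\<^sub>F t in at_right (?c + h). 0 < G t - G h - ?b * (t - h)"
    by (rule order_tendstoD)
  moreover have "\<forall>\<^sub>F t in at_right (?c + h). t < 1"
    by (rule eventually_at_rightI[of _ 1]) (use h in auto)
  moreover have "\<forall>\<^sub>F t in at_right (?c + h). ?c + h < t"
    by (rule eventually_at_right_less)
  ultimately have "\<forall>\<^sub>F t in at_right (?c + h). ?c + h < t \<and> t < 1 \<and> ?b * (t - h) < G t - G h"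
    by eventually_elim auto
  then obtain t where t: "?c + h < t" "t < 1" "?b * (t - h) < G t - G h"
    using eventually_happens'[OF trivial_limit_at_right_real] by blast
  then have "t - h \<le> opt_width \<alpha> \<pi>\<^sub>0 G"
    using width_le_opt_width[OF \<alpha>(1) \<pi> G(1,2), of "(h, t)"] h c
    by (simp add: intervals_from_def)
  then show ?thesis
    using t by simp
qed

text \<open>
If some optimal interval becomes strictly feasible as soon as one of its ends is pulled in, then
widths arbitrarily close to the optimum are attained with a margin.  The margin is what random
fluctuations cannot destroy; an optimal interval itself has none, so its empirical counterpart
may be infeasible for arbitrarily large samples.
\<close>

lemma strictly_feasible_near_opt_width:
  assumes \<alpha>: "0 < \<alpha>" and \<pi>: "0 < \<pi>\<^sub>0" "\<pi>\<^sub>0 < 1" and G: "mono G"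
    and pos: "0 < opt_width \<alpha> \<pi>\<^sub>0 G" and st: "(s, t) \<in> opt_intervals \<alpha> \<pi>\<^sub>0 G"
    and strict: "strictly_decreasing_at (\<lambda>u. FDR_inf \<pi>\<^sub>0 G u t) s \<or>
      strictly_increasing_at (\<lambda>u. FDR_inf \<pi>\<^sub>0 G s u) t"
    and "0 < \<epsilon>"
  shows "\<exists>u v. 0 \<le> u \<and> u \<le> 1 \<and> u < v \<and> v \<le> 1 \<and>
    critical_slope \<alpha> \<pi>\<^sub>0 * (v - u) < G v - G u \<and> opt_width \<alpha> \<pi>\<^sub>0 G - \<epsilon> < v - u"
proof -
  let ?\<delta> = "opt_width \<alpha> \<pi>\<^sub>0 G"
  note FDR_less_iff = FDR_inf_level_iff(2)[OF \<alpha> \<pi> G]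
  have st: "0 \<le> s" "t \<le> 1" "t - s = ?\<delta>" "FDR_inf \<pi>\<^sub>0 G s t \<le> \<alpha>"
    using st unfolding opt_intervals_def opt_feasible_def by auto
  have room: "\<exists>h>0. h \<le> e \<and> h < \<epsilon> \<and> h < ?\<delta>" if "0 < e" for e :: real
    using that \<open>0 < \<epsilon>\<close> pos by (intro exI[of _ "min e (min \<epsilon> ?\<delta> / 2)"]) auto
  from strict show ?thesis
  proof
    assume "strictly_decreasing_at (\<lambda>u. FDR_inf \<pi>\<^sub>0 G u t) s"
    then obtain e where e: "0 < e"
      "\<And>u. s < u \<Longrightarrow> u \<le> s + e \<Longrightarrow> FDR_inf \<pi>\<^sub>0 G u t < FDR_inf \<pi>\<^sub>0 G s t"
      unfolding strictly_decreasing_at_def by auto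
    obtain h where h: "0 < h" "h \<le> e" "h < \<epsilon>" "h < ?\<delta>"
      using room[OF e(1)] by auto
    have "FDR_inf \<pi>\<^sub>0 G (s + h) t < \<alpha>"
      using e(2)[of "s + h"] h st(4) by auto
    then have "critical_slope \<alpha> \<pi>\<^sub>0 * (t - (s + h)) < G t - G (s + h)"
      using FDR_less_iff[of "s + h" t] h st(3) by auto
    then show ?thesis
      using st h by (intro exI[of _ "s + h"] exI[of _ t]) auto
  next
    assume "strictly_increasing_at (\<lambda>u. FDR_inf \<pi>\<^sub>0 G s u) t"
    then obtain e where e: "0 < e"
      "\<And>u. t - e \<le> u \<Longrightarrow> u < t \<Longrightarrow> FDR_inf \<pi>\<^sub>0 G s u < FDR_inf \<pi>\<^sub>0 G s t"
      unfolding strictly_increasing_at_def by auto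
    obtain h where h: "0 < h" "h \<le> e" "h < \<epsilon>" "h < ?\<delta>"
      using room[OF e(1)] by auto
    have "FDR_inf \<pi>\<^sub>0 G s (t - h) < \<alpha>"
      using e(2)[of "t - h"] h st(4) by auto
    then have "critical_slope \<alpha> \<pi>\<^sub>0 * ((t - h) - s) < G (t - h) - G s"
      using FDR_less_iff[of s "t - h"] h st(3) by auto
    then show ?thesis
      using st h by (intro exI[of _ s] exI[of _ "t - h"]) auto
  qed
qed

section \<open>Selection of the left-most longest feasible interval\<close>

text \<open>
The rule behind both procedures: among the feasible intervals that start at or before \<open>a\<close>, the
longest, and of these the left-most.  A first-order characterisation in place of \<open>THE\<close> or
\<open>GREATEST\<close> lets properties be read off without knowing beforehand that the choice is well
defined.
\<close>

definition leftmost_longest ::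
    "real \<Rightarrow> real \<Rightarrow> nat \<Rightarrow> nat set \<Rightarrow> (nat \<Rightarrow> real) \<Rightarrow> real \<times> real \<Rightarrow> bool" where
  "leftmost_longest a \<alpha> n I p x \<longleftrightarrow> x \<in> scan_feasible \<alpha> n I p \<and> fst x \<le> a \<and>
     (\<forall>y \<in> scan_feasible \<alpha> n I p. fst y \<le> a \<longrightarrow>
        snd y - fst y < snd x - fst x \<or> (snd y - fst y = snd x - fst x \<and> fst x \<le> fst y))"

lemma leftmost_longest_unique:
  assumes "leftmost_longest a \<alpha> n I p x" "leftmost_longest a \<alpha> n I p y"
  shows "x = y"
proof -
  have "snd y - fst y < snd x - fst x \<or> (snd y - fst y = snd x - fst x \<and> fst x \<le> fst y)"
    "snd x - fst x < snd y - fst y \<or> (snd x - fst x = snd y - fst y \<and> fst y \<le> fst x)"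
    using assms unfolding leftmost_longest_def by blast+
  then have "fst x = fst y \<and> snd x = snd y"
    by linarith
  then show ?thesis
    by (simp add: prod_eq_iff)
qed

lemma scan_interval_eqI:
  assumes "leftmost_longest 1 \<alpha> n I p x"
  shows "scan_interval \<alpha> n I p = x"
proof -
  have fst_le: "fst y \<le> 1" if "y \<in> scan_feasible \<alpha> n I p" for y
    using that unfolding scan_feasible_def by auto
  have max_iff: "y \<in> scan_maximizers \<alpha> n I p \<longleftrightarrow> y \<in> scan_feasible \<alpha> n I p \<and>
      (\<forall>z \<in> scan_feasible \<alpha> n I p. snd z - fst z \<le> snd y - fst y)" for y
    unfolding scan_maximizers_def is_arg_max_def by (auto simp: case_prod_unfold not_less)
  have x: "x \<in> scan_maximizers \<alpha> n I p"
    "\<And>y. y \<in> scan_maximizers \<alpha> n I p \<Longrightarrow> fst x \<le> fst y"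
    using assms fst_le unfolding max_iff leftmost_longest_def by (force, fastforce)
  show ?thesis
    unfolding scan_interval_def
  proof (rule the_equality)
    fix y assume y: "y \<in> scan_maximizers \<alpha> n I p \<and>
      (\<forall>z \<in> scan_maximizers \<alpha> n I p. fst y \<le> fst z)"
    then have "fst y \<le> fst x" "fst x \<le> fst y"
      using x by auto
    moreover have "snd y - fst y \<le> snd x - fst x" "snd x - fst x \<le> snd y - fst y"
      using x(1) y unfolding max_iff by auto
    ultimately have "fst y = fst x" "snd y = snd x"
      by linarith+
    then show "y = x"
      by (simp add: prod_eq_iff)
  qed (use x in auto)
qed

lemma BH_threshold_eqI:
  assumes "leftmost_longest 0 \<alpha> n I p x"
  shows "x = (0, BH_threshold \<alpha> n I p)"
proof -
  obtain t where x: "x = (0, t)"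
    using assms unfolding leftmost_longest_def scan_feasible_def by (cases x) auto
  have "BH_threshold \<alpha> n I p = t"
    unfolding BH_threshold_def
  proof (rule Greatest_equality)
    show "0 \<le> t \<and> t \<le> 1 \<and> FDR_hat n I p 0 t \<le> \<alpha>"
      using assms unfolding x leftmost_longest_def scan_feasible_def by auto
  next
    fix u assume "0 \<le> u \<and> u \<le> 1 \<and> FDR_hat n I p 0 u \<le> \<alpha>"
    then have "(0, u) \<in> scan_feasible \<alpha> n I p"
      unfolding scan_feasible_def by auto
    then show "u \<le> t"
      using assms unfolding x leftmost_longest_def by force
  qed
  then show ?thesis
    using x by simp
qed

lemma scan_feasible_iff:
  assumes "0 < n"
  shows "(s, t) \<in> scan_feasible \<alpha> n I p \<longleftrightarrow> 0 \<le> s \<and> s \<le> t \<and> t \<le> 1 \<and>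
    t - s \<le> \<alpha> * real (max (R_count n I p s t) 1) / real n"
proof -
  have "0 < real (max (R_count n I p s t) 1)"
    by simp
  then have "FDR_hat n I p s t \<le> \<alpha> \<longleftrightarrow> t - s \<le> \<alpha> * real (max (R_count n I p s t) 1) / real n"
    unfolding FDR_hat_def using assms
    by (simp only: divide_le_eq le_divide_eq mult.commute) (simp add: mult.commute)
  then show ?thesis
    unfolding scan_feasible_def by auto
qed

text \<open>
The intervals \<open>[0, w]\<close> and \<open>[max 0 (p j - w), max 0 (p j - w) + w]\<close> with \<open>w = \<alpha> * k / n\<close>, coded by \<open>b = (j, k)\<close>;
\<open>j = 0\<close> stands for the former.  The width \<open>w\<close> is the largest that level \<open>\<alpha>\<close> permits with \<open>k\<close>
rejections.
\<close>

definition candidate :: "real \<Rightarrow> nat \<Rightarrow> (nat \<Rightarrow> real) \<Rightarrow> nat \<times> nat \<Rightarrow> real \<times> real" where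
  "candidate \<alpha> n p b =
     (let w = \<alpha> * real (snd b) / real n; s = (if fst b = 0 then 0 else max 0 (p (fst b) - w))
      in (s, s + w))"

lemma R_count_mono:
  assumes "I \<subseteq> {1..n}"
    and "\<And>i. i \<in> {1..n} \<Longrightarrow> s \<le> p i \<Longrightarrow> p i \<le> t \<Longrightarrow> s' \<le> p i \<and> p i \<le> t'"
  shows "R_count n I p s t \<le> R_count n I p s' t'"
proof -
  have "{i \<in> {1..n}. s \<le> p i \<and> p i \<le> t} \<subseteq> {i \<in> {1..n}. s' \<le> p i \<and> p i \<le> t'}"
    using assms(2) by blast
  then show ?thesis
    unfolding R_count_eq_card[OF assms(1)] by (intro card_mono) simp_all
qed

lemma R_count_le:
  assumes "I \<subseteq> {1..n}"
  shows "R_count n I p s t \<le> n"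
proof -
  have "card {i \<in> {1..n}. s \<le> p i \<and> p i \<le> t} \<le> card {1..n}"
    by (rule card_mono) auto
  then show ?thesis
    unfolding R_count_eq_card[OF assms] by simp
qed

text \<open>
Take a feasible interval with \<open>k\<close> P-values, the largest being \<open>p j\<close>.  The interval of the full
permitted width \<open>w = \<alpha> * k / n\<close> that ends in \<open>p j\<close>, or that starts in \<open>0\<close> should \<open>p j < w\<close>, still
covers all these P-values, so it is feasible; it is at least as long and starts no further to the
right.  An interval without P-values is no longer than the feasible \<open>[0, \<alpha> / n]\<close>.  Hence finitely many intervals, all explicit functions of the P-values, decide the
optimisation: this replaces a compactness argument for existence, determines the optimal width
exactly, and yields measurability.
\<close>

lemma candidate_dominates:
  assumes \<alpha>: "0 < \<alpha>" "\<alpha> < 1" and n: "0 < n" and I: "I \<subseteq> {1..n}"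
    and p: "\<And>i. i \<in> {1..n} \<Longrightarrow> p i \<in> {0..1}"
    and feasible: "(s, t) \<in> scan_feasible \<alpha> n I p"
  defines "k \<equiv> max (R_count n I p s t) 1"
  shows "\<exists>j \<le> n. candidate \<alpha> n p (j, k) \<in> scan_feasible \<alpha> n I p \<and>
    fst (candidate \<alpha> n p (j, k)) \<le> s"
proof -
  define w where "w = \<alpha> * real k / real n"
  have k: "1 \<le> k" "k \<le> n"
    using R_count_le[OF I] n unfolding k_def by (auto simp: Suc_le_eq)
  have "\<alpha> * real k \<le> 1 * real n"
    using k \<alpha> by (intro mult_mono) auto
  then have w: "0 < w" "w \<le> 1"
    unfolding w_def using k n \<alpha> by (auto simp: divide_le_eq)
  have st: "0 \<le> s" "s \<le> t" "t \<le> 1" "t - s \<le> w"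
    using feasible scan_feasible_iff[OF n] unfolding k_def w_def by auto
  have feasibleI: "(c, c + w) \<in> scan_feasible \<alpha> n I p"
    if "0 \<le> c" "c + w \<le> 1" "k \<le> max (R_count n I p c (c + w)) 1" for c
  proof -
    have "\<alpha> * real k / real n \<le> \<alpha> * real (max (R_count n I p c (c + w)) 1) / real n"
      by (intro divide_right_mono mult_left_mono) (use that(3) \<alpha> in auto)
    then have "w \<le> \<alpha> * real (max (R_count n I p c (c + w)) 1) / real n"
      unfolding w_def[symmetric] .
    then show ?thesis
      unfolding scan_feasible_iff[OF n] using that w by auto
  qed
  let ?J = "{i \<in> {1..n}. s \<le> p i \<and> p i \<le> t}"
  show ?thesis
  proof (cases "?J = {}")
    case True
    then have "k = 1"
      unfolding k_def R_count_eq_card[OF I] by (simp only: card.empty)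
    then have "(0, 0 + w) \<in> scan_feasible \<alpha> n I p"
      by (intro feasibleI) (use w in auto)
    moreover have "candidate \<alpha> n p (0, k) = (0, 0 + w)"
      unfolding candidate_def w_def by (simp add: Let_def)
    ultimately show ?thesis
      using st by (intro exI[of _ 0]) simp
  next
    case False
    then obtain j where j: "j \<in> ?J" "\<And>i. i \<in> ?J \<Longrightarrow> p i \<le> p j"
      using finite_has_maximal[of "p ` ?J"] by fastforce
    define c where "c = max 0 (p j - w)"
    have c: "0 \<le> c" "c \<le> s" "c + w \<le> 1" "p j \<le> c + w"
      using j(1) st w unfolding c_def by auto
    have "R_count n I p s t \<le> R_count n I p c (c + w)"
    proof (rule R_count_mono[OF I])
      fix i assume "i \<in> {1..n}" "s \<le> p i" "p i \<le> t"
      then show "c \<le> p i \<and> p i \<le> c + w"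
        using j(2)[of i] c by auto
    qed
    then have "(c, c + w) \<in> scan_feasible \<alpha> n I p"
      by (intro feasibleI c) (simp add: k_def max_def)
    moreover have "candidate \<alpha> n p (j, k) = (c, c + w)"
      using j(1) unfolding candidate_def w_def c_def by (simp add: Let_def)
    ultimately show ?thesis
      using j(1) c by (intro exI[of _ j]) auto
  qed
qed

text \<open>
For candidates, comparing widths is comparing the indices \<open>k\<close>, so the rule of
\<open>leftmost_longest\<close> becomes a finite combination of inequalities between P-values.
\<close>

definition best_candidate ::
    "real \<Rightarrow> real \<Rightarrow> nat \<Rightarrow> nat set \<Rightarrow> (nat \<Rightarrow> real) \<Rightarrow> nat \<times> nat \<Rightarrow> bool" where
  "best_candidate a \<alpha> n I p b \<longleftrightarrow>
     candidate \<alpha> n p b \<in> scan_feasible \<alpha> n I p \<and> fst (candidate \<alpha> n p b) \<le> a \<and>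
     (\<forall>c \<in> {..n} \<times> {1..n}.
        candidate \<alpha> n p c \<in> scan_feasible \<alpha> n I p \<and> fst (candidate \<alpha> n p c) \<le> a \<longrightarrow>
        snd c < snd b \<or> (snd c = snd b \<and> fst (candidate \<alpha> n p b) \<le> fst (candidate \<alpha> n p c)))"

lemma width_candidate: "snd (candidate \<alpha> n p b) - fst (candidate \<alpha> n p b) = \<alpha> * real (snd b) / real n"
  unfolding candidate_def by (simp add: Let_def)

lemma best_candidate_exists:
  assumes "0 \<le> a" and \<alpha>: "0 < \<alpha>" "\<alpha> < 1" and n: "0 < n" and I: "I \<subseteq> {1..n}"
    and p: "\<And>i. i \<in> {1..n} \<Longrightarrow> p i \<in> {0..1}"
  shows "\<exists>b \<in> {..n} \<times> {1..n}. best_candidate a \<alpha> n I p b"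
proof -
  let ?c = "candidate \<alpha> n p"
  define B where "B = {b \<in> {..n} \<times> {1..n}. ?c b \<in> scan_feasible \<alpha> n I p \<and> fst (?c b) \<le> a}"
  have fin: "finite B"
    unfolding B_def by simp
  have "(0, 0) \<in> scan_feasible \<alpha> n I p"
    unfolding scan_feasible_iff[OF n] using \<alpha> by simp
  from candidate_dominates[where p = p, OF \<alpha> n I p this] obtain j where
    "j \<le> n" "?c (j, max (R_count n I p 0 0) 1) \<in> scan_feasible \<alpha> n I p"
    "fst (?c (j, max (R_count n I p 0 0) 1)) \<le> 0"
    by blast
  then have "(j, max (R_count n I p 0 0) 1) \<in> B"
    unfolding B_def using R_count_le[OF I] n \<open>0 \<le> a\<close> by auto
  then have ne: "B \<noteq> {}" by blast
  define k where "k = Max (snd ` B)"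
  have "k \<in> snd ` B"
    unfolding k_def using fin ne by (intro Max_in) auto
  then have ne': "{b \<in> B. snd b = k} \<noteq> {}" by auto
  let ?b = "arg_min_on (\<lambda>b. fst (?c b)) {b \<in> B. snd b = k}"
  have "?b \<in> {b \<in> B. snd b = k}"
    using fin ne' by (intro arg_min_if_finite) auto
  moreover have "fst (?c ?b) \<le> fst (?c c)" if "c \<in> B" "snd c = k" for c
    using that by (intro arg_min_least[OF _ ne']) (use fin in auto)
  ultimately obtain b where b: "b \<in> B" "snd b = k"
    "\<And>c. c \<in> B \<Longrightarrow> snd c = k \<Longrightarrow> fst (?c b) \<le> fst (?c c)"
    by blast
  have "snd c < snd b \<or> (snd c = snd b \<and> fst (?c b) \<le> fst (?c c))" if "c \<in> B" for c
  proof -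
    have "snd c \<le> k"
      unfolding k_def using that fin by (intro Max_ge) auto
    then show ?thesis
      using b(2) b(3)[OF that] by (auto simp: le_less)
  qed
  then show ?thesis
    using b(1) unfolding best_candidate_def B_def by blast
qed

lemma best_candidate_leftmost_longest:
  assumes \<alpha>: "0 < \<alpha>" "\<alpha> < 1" and n: "0 < n" and I: "I \<subseteq> {1..n}"
    and p: "\<And>i. i \<in> {1..n} \<Longrightarrow> p i \<in> {0..1}"
    and b: "best_candidate a \<alpha> n I p b"
  shows "leftmost_longest a \<alpha> n I p (candidate \<alpha> n p b)"
  unfolding leftmost_longest_def
proof (intro conjI ballI impI)
  let ?c = "candidate \<alpha> n p"
  show "?c b \<in> scan_feasible \<alpha> n I p" "fst (?c b) \<le> a"
    using b unfolding best_candidate_def by auto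
  fix y assume y: "y \<in> scan_feasible \<alpha> n I p" "fst y \<le> a"
  obtain s t where st: "y = (s, t)" by (cases y)
  define k where "k = max (R_count n I p s t) 1"
  have "t - s \<le> \<alpha> * real k / real n"
    using y(1) scan_feasible_iff[OF n] unfolding st k_def by auto
  obtain j where j: "j \<le> n" "?c (j, k) \<in> scan_feasible \<alpha> n I p" "fst (?c (j, k)) \<le> s"
    using candidate_dominates[where p = p, OF \<alpha> n I p y(1)[unfolded st]] unfolding k_def by blast
  have "(j, k) \<in> {..n} \<times> {1..n}"
    using j(1) R_count_le[OF I] n unfolding k_def by auto
  then have "k < snd b \<or> (k = snd b \<and> fst (?c b) \<le> fst (?c (j, k)))"
    using b j y(2) unfolding best_candidate_def st by fastforce
  moreover have "\<alpha> * real k / real n < \<alpha> * real (snd b) / real n" if "k < snd b"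
    using that \<alpha> n by (simp add: divide_strict_right_mono)
  ultimately have "t - s < \<alpha> * real (snd b) / real n \<or>
      (t - s \<le> \<alpha> * real (snd b) / real n \<and> fst (?c b) \<le> s)"
    using \<open>t - s \<le> _\<close> j(3) by fastforce
  then show "snd y - fst y < snd (?c b) - fst (?c b) \<or>
      (snd y - fst y = snd (?c b) - fst (?c b) \<and> fst (?c b) \<le> fst y)"
    unfolding width_candidate st by auto
qed

lemma leftmost_longest_exists:
  assumes "0 \<le> a" "0 < \<alpha>" "\<alpha> < 1" "0 < n" "I \<subseteq> {1..n}"
    and "\<And>i. i \<in> {1..n} \<Longrightarrow> p i \<in> {0..1}"
  shows "\<exists>x. leftmost_longest a \<alpha> n I p x"
  using best_candidate_exists[where p = p, OF assms]
    best_candidate_leftmost_longest[where p = p, OF assms(2-6)] by blast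

text \<open>
Feasibility bounds the width by the right-hand side, and the dominating candidate has exactly
that width.  This equality pins down the empirical excess of a selected interval.
\<close>

lemma leftmost_longest_width:
  assumes \<alpha>: "0 < \<alpha>" "\<alpha> < 1" and n: "0 < n" and I: "I \<subseteq> {1..n}"
    and p: "\<And>i. i \<in> {1..n} \<Longrightarrow> p i \<in> {0..1}"
    and x: "leftmost_longest a \<alpha> n I p (s, t)"
  shows "t - s = \<alpha> * real (max (R_count n I p s t) 1) / real n"
proof (rule antisym)
  have st: "(s, t) \<in> scan_feasible \<alpha> n I p" "s \<le> a"
    using x unfolding leftmost_longest_def by auto
  then show "t - s \<le> \<alpha> * real (max (R_count n I p s t) 1) / real n"
    using scan_feasible_iff[OF n] by auto
  obtain j where j: "candidate \<alpha> n p (j, max (R_count n I p s t) 1) \<in> scan_feasible \<alpha> n I p"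
      "fst (candidate \<alpha> n p (j, max (R_count n I p s t) 1)) \<le> s"
    using candidate_dominates[where p = p, OF \<alpha> n I p st(1)] by blast
  then show "\<alpha> * real (max (R_count n I p s t) 1) / real n \<le> t - s"
    using x st(2) width_candidate[of \<alpha> n p "(j, max (R_count n I p s t) 1)"]
    unfolding leftmost_longest_def by force
qed

section \<open>Measurability of the selection\<close>

lemma borel_measurable_card_interval:
  fixes P :: "nat \<Rightarrow> 'a \<Rightarrow> real"
  assumes "finite A" "\<And>i. i \<in> A \<Longrightarrow> P i \<in> borel_measurable M"
    and "s \<in> borel_measurable M" "t \<in> borel_measurable M"
  shows "(\<lambda>\<omega>. real (card {i \<in> A. s \<omega> \<le> P i \<omega> \<and> P i \<omega> \<le> t \<omega>})) \<in> borel_measurable M"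
proof -
  have "real (card {i \<in> A. s \<omega> \<le> P i \<omega> \<and> P i \<omega> \<le> t \<omega>}) =
      (\<Sum>i\<in>A. if s \<omega> \<le> P i \<omega> \<and> P i \<omega> \<le> t \<omega> then 1 else 0)" for \<omega>
    using assms(1) by (simp add: sum.If_cases Int_def)
  moreover have "(\<lambda>\<omega>. if s \<omega> \<le> P i \<omega> \<and> P i \<omega> \<le> t \<omega> then 1 else 0 :: real) \<in> borel_measurable M"
    if "i \<in> A" for i
    using assms(2)[OF that] assms(3,4) by measurable
  ultimately show ?thesis
    by simp
qed

text \<open>
A candidate depends on a single P-value, and being the best is a finite combination of
measurable conditions.
\<close>

lemma best_candidate_measurable:
  fixes P :: "nat \<Rightarrow> 'a \<Rightarrow> real" and a \<alpha> :: real
  assumes n: "0 < n" and I: "I \<subseteq> {1..n}"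
    and P: "\<And>i. i \<in> {1..n} \<Longrightarrow> P i \<in> borel_measurable M"
  defines "c \<equiv> \<lambda>b \<omega>. candidate \<alpha> n (\<lambda>i. P i \<omega>) b"
  shows "b \<in> {..n} \<times> {1..n} \<Longrightarrow> (\<lambda>\<omega>. fst (c b \<omega>)) \<in> borel_measurable M"
    and "b \<in> {..n} \<times> {1..n} \<Longrightarrow> (\<lambda>\<omega>. snd (c b \<omega>)) \<in> borel_measurable M"
    and "b \<in> {..n} \<times> {1..n} \<Longrightarrow> {\<omega> \<in> space M. best_candidate a \<alpha> n I (\<lambda>i. P i \<omega>) b} \<in> sets M"
proof -
  have fst_meas: "(\<lambda>\<omega>. fst (c b \<omega>)) \<in> borel_measurable M" if "b \<in> {..n} \<times> {1..n}" for b
  proof (cases "fst b = 0")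
    case True
    then show ?thesis
      unfolding c_def candidate_def by (simp add: Let_def)
  next
    case False
    then have [measurable]: "P (fst b) \<in> borel_measurable M"
      using that by (intro P) auto
    show ?thesis
      unfolding c_def candidate_def Let_def using False by simp
  qed
  have snd_eq: "snd (c b \<omega>) = fst (c b \<omega>) + \<alpha> * real (snd b) / real n" for b \<omega>
    unfolding c_def candidate_def by (simp add: Let_def)
  have snd_meas: "(\<lambda>\<omega>. snd (c b \<omega>)) \<in> borel_measurable M" if "b \<in> {..n} \<times> {1..n}" for b
    unfolding snd_eq using fst_meas[OF that] by measurable
  show "b \<in> {..n} \<times> {1..n} \<Longrightarrow> (\<lambda>\<omega>. fst (c b \<omega>)) \<in> borel_measurable M"
    "b \<in> {..n} \<times> {1..n} \<Longrightarrow> (\<lambda>\<omega>. snd (c b \<omega>)) \<in> borel_measurable M"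
    by (fact fst_meas snd_meas)+
  define Q where "Q b \<omega> \<longleftrightarrow> c b \<omega> \<in> scan_feasible \<alpha> n I (\<lambda>i. P i \<omega>) \<and> fst (c b \<omega>) \<le> a" for b \<omega>
  have Q_meas: "Measurable.pred M (Q b)"
    if b: "b \<in> {..n} \<times> {1..n}" for b
  proof -
    note [measurable] = fst_meas[OF b] snd_meas[OF b]
    have [measurable]: "(\<lambda>\<omega>. real (R_count n I (\<lambda>i. P i \<omega>) (fst (c b \<omega>)) (snd (c b \<omega>))))
        \<in> borel_measurable M"
      unfolding R_count_eq_card[OF I]
      by (intro borel_measurable_card_interval) (use P in measurable)
    have "c b \<omega> \<in> scan_feasible \<alpha> n I (\<lambda>i. P i \<omega>) \<longleftrightarrow>
        0 \<le> fst (c b \<omega>) \<and> fst (c b \<omega>) \<le> snd (c b \<omega>) \<and> snd (c b \<omega>) \<le> 1 \<and>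
        snd (c b \<omega>) - fst (c b \<omega>) \<le>
          \<alpha> * max (real (R_count n I (\<lambda>i. P i \<omega>) (fst (c b \<omega>)) (snd (c b \<omega>)))) 1 / real n" for \<omega>
      using scan_feasible_iff[OF n, where p = "\<lambda>i. P i \<omega>", of "fst (c b \<omega>)" "snd (c b \<omega>)" \<alpha> I]
      by (simp add: of_nat_max)
    then show ?thesis
      unfolding Q_def by simp
  qed
  show "{\<omega> \<in> space M. best_candidate a \<alpha> n I (\<lambda>i. P i \<omega>) b} \<in> sets M"
    if b: "b \<in> {..n} \<times> {1..n}"
  proof -
    note [measurable] = Q_meas[OF b] fst_meas[OF b]
    have "Measurable.pred M (\<lambda>\<omega>. Q b \<omega> \<and> (\<forall>d \<in> {..n} \<times> {1..n}. Q d \<omega> \<longrightarrow>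
        snd d < snd b \<or> (snd d = snd b \<and> fst (c b \<omega>) \<le> fst (c d \<omega>))))"
    proof (intro pred_intros_logic(3) pred_intros_finite Q_meas[OF b])
      fix d assume d: "d \<in> {..n} \<times> {1..n}"
      note [measurable] = Q_meas[OF d] fst_meas[OF d]
      show "Measurable.pred M (\<lambda>\<omega>. Q d \<omega> \<longrightarrow>
          snd d < snd b \<or> (snd d = snd b \<and> fst (c b \<omega>) \<le> fst (c d \<omega>)))"
        by measurable
    qed auto
    then show ?thesis
      unfolding best_candidate_def Q_def c_def pred_def by (simp add: conj_assoc)
  qed
qed

text \<open>
The sample space is covered by the finitely many events that a given candidate is the best, and
on each of them the selected interval is that candidate.  Measurability has to be established
because the integral of a function that is not integrable is \<open>0\<close> by convention.
\<close>

lemma FNP_leftmost_longest_measurable: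
  fixes P :: "nat \<Rightarrow> 'a \<Rightarrow> real"
  assumes \<alpha>: "0 \<le> a" "0 < \<alpha>" "\<alpha> < 1" and n: "0 < n" and I: "I \<subseteq> {1..n}"
    and P: "\<And>i. i \<in> {1..n} \<Longrightarrow> P i \<in> borel_measurable M"
    and P01: "\<And>i \<omega>. i \<in> {1..n} \<Longrightarrow> \<omega> \<in> space M \<Longrightarrow> P i \<omega> \<in> {0..1}"
    and X: "\<And>\<omega>. \<omega> \<in> space M \<Longrightarrow> leftmost_longest a \<alpha> n I (\<lambda>i. P i \<omega>) (X \<omega>)"
  shows "(\<lambda>\<omega>. FNP n I (\<lambda>i. P i \<omega>) (fst (X \<omega>)) (snd (X \<omega>))) \<in> borel_measurable M"
proof (rule measurable_piecewise_restrict)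
  let ?E = "\<lambda>b. {\<omega> \<in> space M. best_candidate a \<alpha> n I (\<lambda>i. P i \<omega>) b}"
  let ?C = "?E ` ({..n} \<times> {1..n})"
  show "countable ?C" by simp
  show "space M \<subseteq> \<Union> ?C"
    using best_candidate_exists[OF \<alpha> n I] P01 by fast
  fix \<Omega> assume "\<Omega> \<in> ?C"
  then obtain b where b: "b \<in> {..n} \<times> {1..n}" "\<Omega> = ?E b" by blast
  show "\<Omega> \<inter> space M \<in> sets M"
    using best_candidate_measurable(3)[OF n I P b(1)] b(2) by auto
  let ?c = "\<lambda>\<omega>. candidate \<alpha> n (\<lambda>i. P i \<omega>) b"
  have "(\<lambda>\<omega>. FNP n I (\<lambda>i. P i \<omega>) (fst (?c \<omega>)) (snd (?c \<omega>))) \<in> borel_measurable M"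
    unfolding FNP_def S_count_def
    by (intro borel_measurable_diff borel_measurable_divide borel_measurable_const
        borel_measurable_card_interval best_candidate_measurable(1,2)[OF n I P b(1)])
      (use P in auto)
  then have "(\<lambda>\<omega>. FNP n I (\<lambda>i. P i \<omega>) (fst (?c \<omega>)) (snd (?c \<omega>))) \<in> borel_measurable (restrict_space M \<Omega>)"
    by (rule measurable_restrict_space1)
  moreover have "X \<omega> = ?c \<omega>" if "\<omega> \<in> space (restrict_space M \<Omega>)" for \<omega>
  proof (rule leftmost_longest_unique)
    have \<omega>: "\<omega> \<in> space M" "best_candidate a \<alpha> n I (\<lambda>i. P i \<omega>) b"
      using that b(2) by (auto simp: space_restrict_space)
    show "leftmost_longest a \<alpha> n I (\<lambda>i. P i \<omega>) (X \<omega>)"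
      using X \<omega>(1) .
    show "leftmost_longest a \<alpha> n I (\<lambda>i. P i \<omega>) (?c \<omega>)"
      by (rule best_candidate_leftmost_longest[OF \<alpha>(2,3) n I P01[OF _ \<omega>(1)] \<omega>(2)])
  qed
  ultimately show "(\<lambda>\<omega>. FNP n I (\<lambda>i. P i \<omega>) (fst (X \<omega>)) (snd (X \<omega>)))
      \<in> borel_measurable (restrict_space M \<Omega>)"
    by (subst measurable_cong) auto
qed

section \<open>Uniform convergence of interval counts\<close>

lemma grid_cell:
  fixes x :: real and m :: nat
  assumes "0 < m" "0 \<le> x" "x \<le> 1"
  shows "\<exists>i < m. real i / real m \<le> x \<and> x \<le> real (Suc i) / real m"
proof (cases "x = 1")
  case True
  then show ?thesis
    using assms by (intro exI[of _ "m - 1"]) auto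
next
  case False
  let ?i = "nat \<lfloor>x * real m\<rfloor>"
  have "x * real m < 1 * real m"
    using assms False by (intro mult_strict_right_mono) auto
  moreover have "0 \<le> x * real m"
    using assms by simp
  ultimately have "real ?i \<le> x * real m" "x * real m < real ?i + 1" "?i < m"
    by linarith+
  then show ?thesis
    using assms by (intro exI[of _ ?i]) (auto simp: field_simps)
qed

text \<open>
Polya's argument: pointwise convergence of monotone interval functions to a continuous limit is
uniform.  The endpoints may vary with \<open>n\<close>, so it applies to intervals chosen from the data,
and convergence is required on the grids \<open>i / m\<close> only, a countable family, so that one null set
serves for all intervals.
\<close>

lemma uniform_interval_convergence:
  fixes c :: "nat \<Rightarrow> real \<Rightarrow> real \<Rightarrow> real" and F :: "real \<Rightarrow> real" and s t :: "nat \<Rightarrow> real"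
  assumes F: "continuous_on {0..1} F"
    and nonneg: "\<And>n u v. 0 \<le> c n u v"
    and mono: "\<And>n u v u' v'. u' \<le> u \<Longrightarrow> v \<le> v' \<Longrightarrow> c n u v \<le> c n u' v'"
    and conv: "\<And>i j m :: nat. i < j \<Longrightarrow> j \<le> m \<Longrightarrow>
      (\<lambda>n. c n (real i / real m) (real j / real m)) \<longlonglongrightarrow> F (real j / real m) - F (real i / real m)"
    and st: "\<forall>\<^sub>F n in sequentially. 0 \<le> s n \<and> s n \<le> t n \<and> t n \<le> 1"
  shows "(\<lambda>n. c n (s n) (t n) - (F (t n) - F (s n))) \<longlonglongrightarrow> 0"
proof (rule tendstoI)
  fix e :: real assume "0 < e"
  define \<epsilon> where "\<epsilon> = e / 4"
  have "0 < \<epsilon>"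
    using \<open>0 < e\<close> unfolding \<epsilon>_def by simp
  have "uniformly_continuous_on {0..1} F"
    using F by (intro compact_uniformly_continuous) auto
  then obtain d where d: "0 < d"
    "\<And>x y. x \<in> {0..1} \<Longrightarrow> y \<in> {0..1} \<Longrightarrow> \<bar>y - x\<bar> < d \<Longrightarrow> \<bar>F y - F x\<bar> < \<epsilon>"
    unfolding uniformly_continuous_on_def dist_real_def using \<open>0 < \<epsilon>\<close> by meson
  obtain m :: nat where m: "0 < m" "1 / real m < d"
    using reals_Archimedean[OF d(1)] by (metis inverse_eq_divide zero_less_Suc)
  define g where "g i = real i / real m" for i :: nat
  have g01: "g i \<in> {0..1}" if "i \<le> m" for i
    using that m unfolding g_def by auto
  have g_Suc: "g (Suc i) = g i + 1 / real m" for i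
    unfolding g_def by (simp add: add_divide_distrib)
  have "\<forall>\<^sub>F n in sequentially. \<forall>i \<in> {..m}. \<forall>j \<in> {..m}. i < j \<longrightarrow>
      \<bar>c n (g i) (g j) - (F (g j) - F (g i))\<bar> < \<epsilon>"
  proof (intro eventually_ball_finite ballI)
    fix i j assume ij: "i \<in> {..m}" "j \<in> {..m}"
    show "\<forall>\<^sub>F n in sequentially. i < j \<longrightarrow> \<bar>c n (g i) (g j) - (F (g j) - F (g i))\<bar> < \<epsilon>"
    proof (cases "i < j")
      case True
      then have "(\<lambda>n. c n (g i) (g j)) \<longlonglongrightarrow> F (g j) - F (g i)"
        unfolding g_def using ij by (intro conv) auto
      from tendstoD[OF this \<open>0 < \<epsilon>\<close>] show ?thesis
        by (simp add: dist_real_def)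
    qed simp
  qed auto
  with st show "\<forall>\<^sub>F n in sequentially. dist (c n (s n) (t n) - (F (t n) - F (s n))) 0 < e"
  proof eventually_elim
    case (elim n)
    then have st01: "s n \<in> {0..1}" "t n \<in> {0..1}" "s n \<le> t n"
      by auto
    obtain i where i: "i < m" "g i \<le> s n" "s n \<le> g (Suc i)"
      using grid_cell[OF m(1), of "s n"] st01 unfolding g_def by auto
    have g_mono: "g k \<le> g l" if "k \<le> l" for k l
      using that m(1) unfolding g_def by (simp add: divide_right_mono)
    obtain j where j: "i \<le> j" "j < m" "g j \<le> t n" "t n \<le> g (Suc j)"
    proof -
      obtain j where j: "j < m" "g j \<le> t n" "t n \<le> g (Suc j)"
        using grid_cell[OF m(1), of "t n"] st01 unfolding g_def by auto
      \<comment> \<open>If \<open>t n\<close> is a grid point, its cell may end up to the left of the cell of \<open>s n\<close>; then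
        \<open>s n = t n\<close> and the cell of \<open>s n\<close> serves for both.\<close>
      show thesis
      proof (cases "i \<le> j")
        case False
        then have "t n \<le> g (Suc i)"
          using g_mono[of "Suc j" "Suc i"] j by auto
        then show thesis
          using that[of i] i st01 by auto
      qed (use that j in auto)
    qed
    have F_i: "\<bar>F (s n) - F (g i)\<bar> < \<epsilon>" "\<bar>F (s n) - F (g (Suc i))\<bar> < \<epsilon>"
      and F_j: "\<bar>F (t n) - F (g j)\<bar> < \<epsilon>" "\<bar>F (t n) - F (g (Suc j))\<bar> < \<epsilon>"
      using i j g_Suc[of i] g_Suc[of j] m(2) st01 g01[of i] g01[of "Suc i"] g01[of j] g01[of "Suc j"]
      by (auto intro!: d(2))
    \<comment> \<open>Enlarging the interval to the surrounding grid points costs at most \<open>3 * \<epsilon> < e\<close>.\<close>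
    have upper: "c n (s n) (t n) < F (t n) - F (s n) + e"
    proof -
      have "c n (s n) (t n) \<le> c n (g i) (g (Suc j))"
        using i j by (intro mono) auto
      also have "\<dots> < F (g (Suc j)) - F (g i) + \<epsilon>"
        using elim(2)[rule_format, of i "Suc j"] i j by (auto simp: abs_less_iff)
      finally show ?thesis
        using F_i F_j unfolding \<epsilon>_def by linarith
    qed
    \<comment> \<open>Shrinking it costs as much, unless no grid interval fits inside; then \<open>F\<close> barely moves on it.\<close>
    have lower: "F (t n) - F (s n) - e < c n (s n) (t n)"
    proof (cases "Suc i < j")
      case True
      have "F (g j) - F (g (Suc i)) - \<epsilon> < c n (g (Suc i)) (g j)"
        using elim(2)[rule_format, of "Suc i" j] True i j by (auto simp: abs_less_iff)
      also have "\<dots> \<le> c n (s n) (t n)"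
        using i j by (intro mono) auto
      finally show ?thesis
        using F_i F_j unfolding \<epsilon>_def by linarith
    next
      case False
      then have "j = i \<or> j = Suc i"
        using j(1) by auto
      then have "\<bar>F (s n) - F (g j)\<bar> < \<epsilon>"
        using F_i by auto
      then show ?thesis
        using F_j nonneg[of n "s n" "t n"] unfolding \<epsilon>_def by linarith
    qed
    show ?case
      using upper lower by (simp add: dist_real_def abs_less_iff)
  qed
qed

section \<open>Limits along a sample\<close>

locale limit_problem =
  fixes I :: "nat \<Rightarrow> nat set" and G :: "real \<Rightarrow> real" and \<alpha> \<pi>\<^sub>0 :: real
  assumes \<alpha>: "0 < \<alpha>" "\<alpha> < 1"
    and \<pi>\<^sub>0: "0 < \<pi>\<^sub>0" "\<pi>\<^sub>0 < 1"
    and nulls: "\<And>n. I n \<subseteq> {1..n}"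
    and null_fraction: "(\<lambda>n. real (card (I n)) / real n) \<longlonglongrightarrow> \<pi>\<^sub>0"
    and mono_G: "mono G"
    and cont_G: "continuous_on UNIV G"
begin

abbreviation (input) \<beta> where "\<beta> \<equiv> critical_slope \<alpha> \<pi>\<^sub>0"

abbreviation (input) excess where "excess x \<equiv> G (snd x) - G (fst x) - \<beta> * (snd x - fst x)"

lemma card_nulls_le: "card (I n) \<le> n"
  using card_mono[OF finite_atLeastAtMost nulls, of n] by simp

lemma card_non_nulls: "card ({1..n} - I n) = n - card (I n)"
  using nulls[of n] finite_subset[OF nulls] by (subst card_Diff_subset) auto

lemma FNP_bounds: "0 \<le> FNP n (I n) p s t" "FNP n (I n) p s t \<le> 1"
proof -
  have "S_count n (I n) p s t \<le> card ({1..n} - I n)"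
    unfolding S_count_def by (rule card_mono) auto
  then have "real (S_count n (I n) p s t) \<le> real n - real (card (I n))"
    unfolding card_non_nulls using card_nulls_le[of n] by simp
  then show "0 \<le> FNP n (I n) p s t" "FNP n (I n) p s t \<le> 1"
    unfolding FNP_def using card_nulls_le[of n] by (auto simp: divide_le_eq)
qed

end

text \<open>
One realisation \<open>p\<close> of the P-values along which the empirical counts converge.  The limit theorems
below are deterministic statements about such a sample.
\<close>

locale regular_sample = limit_problem +
  fixes p :: "nat \<Rightarrow> nat \<Rightarrow> real"
  assumes p_range: "\<And>n i. i \<in> {1..n} \<Longrightarrow> p n i \<in> {0..1}"
    and V_grid: "\<And>i j m :: nat. i < j \<Longrightarrow> j \<le> m \<Longrightarrow>
      (\<lambda>n. real (V_count (I n) (p n) (real i / real m) (real j / real m)) / real (card (I n)))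
        \<longlonglongrightarrow> real j / real m - real i / real m"
    and S_grid: "\<And>i j m :: nat. i < j \<Longrightarrow> j \<le> m \<Longrightarrow>
      (\<lambda>n. real (S_count n (I n) (p n) (real i / real m) (real j / real m))
             / (real n - real (card (I n))))
        \<longlonglongrightarrow> G (real j / real m) - G (real i / real m)"
begin

lemma V_uniform:
  assumes "\<forall>\<^sub>F n in sequentially. 0 \<le> s n \<and> s n \<le> t n \<and> t n \<le> 1"
  shows "(\<lambda>n. real (V_count (I n) (p n) (s n) (t n)) / real (card (I n)) - (t n - s n)) \<longlonglongrightarrow> 0"
proof (rule uniform_interval_convergence[where F = "\<lambda>x. x" and
      c = "\<lambda>n u v. real (V_count (I n) (p n) u v) / real (card (I n))"])
  fix n and u v u' v' :: real assume "u' \<le> u" "v \<le> v'"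
  then have "V_count (I n) (p n) u v \<le> V_count (I n) (p n) u' v'"
    unfolding V_count_def using finite_subset[OF nulls] by (intro card_mono) auto
  then show "real (V_count (I n) (p n) u v) / real (card (I n))
      \<le> real (V_count (I n) (p n) u' v') / real (card (I n))"
    by (simp add: divide_right_mono)
qed (use assms V_grid in auto)

lemma S_uniform:
  assumes "\<forall>\<^sub>F n in sequentially. 0 \<le> s n \<and> s n \<le> t n \<and> t n \<le> 1"
  shows "(\<lambda>n. real (S_count n (I n) (p n) (s n) (t n)) / (real n - real (card (I n)))
    - (G (t n) - G (s n))) \<longlonglongrightarrow> 0"
proof (rule uniform_interval_convergence[where F = G and
      c = "\<lambda>n u v. real (S_count n (I n) (p n) u v) / (real n - real (card (I n)))"])
  show "continuous_on {0..1} G"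
    using cont_G continuous_on_subset by blast
  fix n and u v u' v' :: real
  show "0 \<le> real (S_count n (I n) (p n) u v) / (real n - real (card (I n)))"
    using card_nulls_le[of n] by simp
  assume "u' \<le> u" "v \<le> v'"
  then have "S_count n (I n) (p n) u v \<le> S_count n (I n) (p n) u' v'"
    unfolding S_count_def by (intro card_mono) auto
  then show "real (S_count n (I n) (p n) u v) / (real n - real (card (I n)))
      \<le> real (S_count n (I n) (p n) u' v') / (real n - real (card (I n)))"
    using card_nulls_le[of n] by (simp add: divide_right_mono)
qed (use assms S_grid in auto)

text \<open>
Rejections are a mixture of null and non-null rejections.  It stays true without non-nulls or without
nulls: the undefined ratio is \<open>0\<close> and its weight vanishes.
\<close>

lemma R_decomposition:
  assumes "0 < n"
  shows "real (R_count n (I n) (p n) s t) / real n =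
    (real (card (I n)) / real n) * (real (V_count (I n) (p n) s t) / real (card (I n))) +
    (1 - real (card (I n)) / real n) *
      (real (S_count n (I n) (p n) s t) / (real n - real (card (I n))))"
proof -
  have "V_count (I n) (p n) s t = 0" if "card (I n) = 0"
    using that finite_subset[OF nulls[of n]] unfolding V_count_def by simp
  then have V: "(real (card (I n)) / real n) * (real (V_count (I n) (p n) s t) / real (card (I n)))
      = real (V_count (I n) (p n) s t) / real n"
    by auto
  have "S_count n (I n) (p n) s t = 0" if "card (I n) = n"
  proof -
    have "{1..n} - I n = {}"
      using that card_non_nulls[of n] by (metis card_eq_0_iff diff_self_eq_0 finite_Diff finite_atLeastAtMost)
    then show ?thesis
      unfolding S_count_def by (simp only: empty_iff) simp
  qed
  moreover have "1 - real (card (I n)) / real n = (real n - real (card (I n))) / real n"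
    using assms by (simp add: diff_divide_distrib)
  ultimately have S: "(1 - real (card (I n)) / real n) *
      (real (S_count n (I n) (p n) s t) / (real n - real (card (I n))))
      = real (S_count n (I n) (p n) s t) / real n"
    by auto
  show ?thesis
    unfolding V S R_count_def by (simp add: add_divide_distrib)
qed

lemma R_uniform:
  assumes st: "\<forall>\<^sub>F n in sequentially. 0 \<le> s n \<and> s n \<le> t n \<and> t n \<le> 1"
  shows "(\<lambda>n. real (max (R_count n (I n) (p n) (s n) (t n)) 1) / real n
    - (\<pi>\<^sub>0 * (t n - s n) + (1 - \<pi>\<^sub>0) * (G (t n) - G (s n)))) \<longlonglongrightarrow> 0"
proof -
  define a where "a n = real (card (I n)) / real n" for n
  define v where "v n = real (V_count (I n) (p n) (s n) (t n)) / real (card (I n)) - (t n - s n)" for n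
  define z where "z n = real (S_count n (I n) (p n) (s n) (t n)) / (real n - real (card (I n)))
    - (G (t n) - G (s n))" for n
  have a: "a \<longlonglongrightarrow> \<pi>\<^sub>0"
    using null_fraction unfolding a_def .
  have v: "v \<longlonglongrightarrow> 0" and z: "z \<longlonglongrightarrow> 0"
    using V_uniform[OF st] S_uniform[OF st] unfolding v_def z_def by auto
  have "\<forall>\<^sub>F n in sequentially. norm (t n - s n - (G (t n) - G (s n))) \<le> 1 + (G 1 - G 0)"
    using st
  proof eventually_elim
    case (elim n)
    then have "G 0 \<le> G (s n)" "G (s n) \<le> G (t n)" "G (t n) \<le> G 1"
      by (auto intro!: monoD[OF mono_G])
    then show ?case
      using elim by (simp add: abs_le_iff)
  qed
  moreover have "(\<lambda>n. a n - \<pi>\<^sub>0) \<longlonglongrightarrow> 0"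
    using tendsto_diff[OF a tendsto_const[of \<pi>\<^sub>0]] by simp
  ultimately have "(\<lambda>n. (a n - \<pi>\<^sub>0) * (t n - s n - (G (t n) - G (s n)))) \<longlonglongrightarrow> 0"
    by (intro lim_null_mult_right_bounded)
  moreover have "(\<lambda>n. a n * v n + (1 - a n) * z n) \<longlonglongrightarrow> \<pi>\<^sub>0 * 0 + (1 - \<pi>\<^sub>0) * 0"
    by (intro tendsto_intros a v z)
  ultimately have "(\<lambda>n. a n * v n + (1 - a n) * z n + (a n - \<pi>\<^sub>0) * (t n - s n - (G (t n) - G (s n))))
      \<longlonglongrightarrow> (\<pi>\<^sub>0 * 0 + (1 - \<pi>\<^sub>0) * 0) + 0"
    by (rule tendsto_add[rotated])
  moreover have "(\<lambda>n. real (max (R_count n (I n) (p n) (s n) (t n)) 1) / real n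
      - real (R_count n (I n) (p n) (s n) (t n)) / real n) \<longlonglongrightarrow> 0"
  proof (rule Lim_null_comparison[OF always_eventually])
    show "\<forall>n. norm (real (max (R_count n (I n) (p n) (s n) (t n)) 1) / real n
      - real (R_count n (I n) (p n) (s n) (t n)) / real n) \<le> 1 / real n"
      unfolding diff_divide_distrib[symmetric] by (auto simp: max_def divide_right_mono)
  qed (rule lim_1_over_n)
  ultimately have "(\<lambda>n. (a n * v n + (1 - a n) * z n +
        (a n - \<pi>\<^sub>0) * (t n - s n - (G (t n) - G (s n)))) +
      (real (max (R_count n (I n) (p n) (s n) (t n)) 1) / real n
        - real (R_count n (I n) (p n) (s n) (t n)) / real n))
      \<longlonglongrightarrow> (\<pi>\<^sub>0 * 0 + (1 - \<pi>\<^sub>0) * 0 + 0) + 0"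
    by (rule tendsto_add)
  \<comment> \<open>The sum of the error terms regroups to the difference in question.\<close>
  moreover have "\<forall>\<^sub>F n in sequentially. (a n * v n + (1 - a n) * z n +
        (a n - \<pi>\<^sub>0) * (t n - s n - (G (t n) - G (s n)))) +
      (real (max (R_count n (I n) (p n) (s n) (t n)) 1) / real n
        - real (R_count n (I n) (p n) (s n) (t n)) / real n) =
      real (max (R_count n (I n) (p n) (s n) (t n)) 1) / real n
        - (\<pi>\<^sub>0 * (t n - s n) + (1 - \<pi>\<^sub>0) * (G (t n) - G (s n)))"
    using eventually_gt_at_top[of 0]
  proof eventually_elim
    case (elim n)
    show ?case
      unfolding R_decomposition[OF elim] a_def[symmetric] v_def z_def by (simp add: algebra_simps)
  qed
  ultimately show ?thesis
    by (subst (asm) tendsto_cong) (simp_all only: mult_zero_right add_0)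
qed

end

locale selected_intervals = regular_sample +
  fixes a :: real and x :: "nat \<Rightarrow> real \<times> real"
  assumes x: "\<And>n. 0 < n \<Longrightarrow> leftmost_longest a \<alpha> n (I n) (p n) (x n)"
begin

lemma eventually_intervals_from: "\<forall>\<^sub>F n in sequentially. x n \<in> intervals_from a"
  using eventually_gt_at_top[of 0]
proof eventually_elim
  case (elim n)
  then show ?case
    using x[OF elim] unfolding leftmost_longest_def scan_feasible_def intervals_from_def by auto
qed

lemma eventually_interval:
  "\<forall>\<^sub>F n in sequentially. 0 \<le> fst (x n) \<and> fst (x n) \<le> snd (x n) \<and> snd (x n) \<le> 1"
  using eventually_intervals_from
  by eventually_elim (auto simp: intervals_from_def)

text \<open>
By \<open>leftmost_longest_width\<close> a selected interval meets the empirical FDR constraint with equality,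
so by uniform convergence it nearly meets the limiting constraint with equality.
\<close>

lemma excess_tendsto_0: "(\<lambda>n. excess (x n)) \<longlonglongrightarrow> 0"
proof -
  let ?w = "\<lambda>n. snd (x n) - fst (x n)" and ?d = "\<lambda>n. G (snd (x n)) - G (fst (x n))"
  have "(\<lambda>n. real (max (R_count n (I n) (p n) (fst (x n)) (snd (x n))) 1) / real n
    - (\<pi>\<^sub>0 * ?w n + (1 - \<pi>\<^sub>0) * ?d n)) \<longlonglongrightarrow> 0"
    by (rule R_uniform[OF eventually_interval])
  from tendsto_mult_left[OF this, of "- 1 / (1 - \<pi>\<^sub>0)"]
  have "(\<lambda>n. - 1 / (1 - \<pi>\<^sub>0) * (real (max (R_count n (I n) (p n) (fst (x n)) (snd (x n))) 1) / real n
    - (\<pi>\<^sub>0 * ?w n + (1 - \<pi>\<^sub>0) * ?d n))) \<longlonglongrightarrow> 0"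
    by simp
  moreover have "\<forall>\<^sub>F n in sequentially. - 1 / (1 - \<pi>\<^sub>0) *
      (real (max (R_count n (I n) (p n) (fst (x n)) (snd (x n))) 1) / real n
        - (\<pi>\<^sub>0 * ?w n + (1 - \<pi>\<^sub>0) * ?d n)) = excess (x n)"
    using eventually_gt_at_top[of 0]
  proof eventually_elim
    case (elim n)
    have "?w n = \<alpha> * real (max (R_count n (I n) (p n) (fst (x n)) (snd (x n))) 1) / real n"
      using leftmost_longest_width[OF \<alpha> elim nulls, of "p n" a "fst (x n)" "snd (x n)"]
        p_range x[OF elim]
      by simp
    then have R: "real (max (R_count n (I n) (p n) (fst (x n)) (snd (x n))) 1) / real n = ?w n / \<alpha>"
      using \<alpha>(1) by simp
    show ?case
      using critical_slope_gap[OF \<pi>\<^sub>0(2), of "?w n" "?d n" \<alpha>] \<pi>\<^sub>0(2)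
      unfolding R by (simp add: field_simps)
  qed
  ultimately show ?thesis
    by (rule Lim_transform_eventually)
qed

text \<open>
The key to comparing procedures: whatever the cutoff \<open>a\<close>, the fraction of false nulls rejected is
asymptotically \<open>\<beta>\<close> times the width of the selected interval, so the longer interval has the
greater power.
\<close>

lemma power_approximation:
  "(\<lambda>n. 1 - FNP n (I n) (p n) (fst (x n)) (snd (x n)) - \<beta> * (snd (x n) - fst (x n))) \<longlonglongrightarrow> 0"
proof -
  have "(\<lambda>n. real (S_count n (I n) (p n) (fst (x n)) (snd (x n))) / (real n - real (card (I n)))
    - (G (snd (x n)) - G (fst (x n))) + excess (x n)) \<longlonglongrightarrow> 0 + 0"
    by (intro tendsto_add excess_tendsto_0 S_uniform eventually_interval)
  then show ?thesis
    unfolding FNP_def by (simp add: algebra_simps)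
qed

text \<open>
On the compact set of intervals of width at least \<open>\<delta> + \<epsilon>\<close> the excess is negative, hence bounded
away from \<open>0\<close>, whereas the excess of the selected intervals tends to \<open>0\<close>.
\<close>

lemma width_eventually_less:
  assumes bound: "\<forall>y \<in> intervals_from a. 0 \<le> excess y \<longrightarrow> snd y - fst y \<le> \<delta>"
    and "0 < \<epsilon>"
  shows "\<forall>\<^sub>F n in sequentially. snd (x n) - fst (x n) < \<delta> + \<epsilon>"
proof (cases "intervals_from a \<inter> {y. \<delta> + \<epsilon> \<le> snd y - fst y} = {}")
  case True
  from eventually_intervals_from show ?thesis
    by eventually_elim (use True in auto)
next
  case False
  let ?K = "intervals_from a \<inter> {y. \<delta> + \<epsilon> \<le> snd y - fst y}"
  have "closed {y :: real \<times> real. \<delta> + \<epsilon> \<le> snd y - fst y}"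
    by (intro closed_Collect_le continuous_intros)
  then have "compact ?K"
    using compact_intervals_from by blast
  moreover have "continuous_on ?K (\<lambda>y. excess y)"
    by (intro continuous_intros continuous_on_compose2[OF cont_G]; simp)
  ultimately obtain z where z: "z \<in> ?K" "\<And>y. y \<in> ?K \<Longrightarrow> excess y \<le> excess z"
    using continuous_attains_sup[OF _ False] by blast
  have "excess z < 0"
    using bspec[OF bound, of z] z(1) \<open>0 < \<epsilon>\<close> by force
  then have "\<forall>\<^sub>F n in sequentially. excess z < excess (x n)"
    using excess_tendsto_0 by (rule order_tendstoD(1)[rotated])
  with eventually_intervals_from show ?thesis
  proof eventually_elim
    case (elim n)
    show ?case
    proof (rule ccontr)
      assume "\<not> ?thesis"
      then have "x n \<in> ?K"
        using elim(1) by auto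
      then show False
        using z(2)[of "x n"] elim(2) by auto
    qed
  qed
qed

text \<open>
An interval that is strictly feasible in the limit is feasible for all large samples, and the
selected interval is at least as long.
\<close>

lemma width_eventually_ge:
  assumes u: "0 \<le> u" "u \<le> a" "u < v" "v \<le> 1" and "\<beta> * (v - u) < G v - G u"
  shows "\<forall>\<^sub>F n in sequentially. v - u \<le> snd (x n) - fst (x n)"
proof -
  let ?R = "\<lambda>n. real (max (R_count n (I n) (p n) u v) 1) / real n"
  let ?L = "\<pi>\<^sub>0 * (v - u) + (1 - \<pi>\<^sub>0) * (G v - G u)"
  have "0 < ?L - (v - u) / \<alpha>"
    unfolding critical_slope_gap[OF \<pi>\<^sub>0(2)] using assms \<pi>\<^sub>0 by simp
  moreover have "(\<lambda>n. ?R n - ?L) \<longlonglongrightarrow> 0"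
    using R_uniform[of "\<lambda>_. u" "\<lambda>_. v"] u by simp
  ultimately have "\<forall>\<^sub>F n in sequentially. - (?L - (v - u) / \<alpha>) < ?R n - ?L"
    by (intro order_tendstoD(1)) auto
  with eventually_gt_at_top[of 0] show ?thesis
  proof eventually_elim
    case (elim n)
    then have "v - u \<le> \<alpha> * ?R n"
      using \<alpha>(1) by (simp add: divide_less_eq mult.commute)
    then have "(u, v) \<in> scan_feasible \<alpha> n (I n) (p n)"
      using scan_feasible_iff[OF elim(1)] u by simp
    then show ?case
      using x[OF elim(1)] u(2) unfolding leftmost_longest_def by fastforce
  qed
qed

lemma FNP_eventually_greater:
  assumes "\<forall>y \<in> intervals_from a. 0 \<le> excess y \<longrightarrow> snd y - fst y \<le> \<delta>"
    and "0 < \<epsilon>"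
  shows "\<forall>\<^sub>F n in sequentially. 1 - \<beta> * \<delta> - \<epsilon> < FNP n (I n) (p n) (fst (x n)) (snd (x n))"
proof -
  have \<beta>: "0 < \<beta>"
    using critical_slope_gt_1[OF \<alpha> \<pi>\<^sub>0(2)] by simp
  then have "0 < \<epsilon> / (2 * \<beta>)" "0 < \<epsilon> / 2"
    using \<open>0 < \<epsilon>\<close> by auto
  from width_eventually_less[OF assms(1) this(1)] order_tendstoD(2)[OF power_approximation this(2)]
  show ?thesis
  proof eventually_elim
    case (elim n)
    have "\<beta> * (snd (x n) - fst (x n)) < \<beta> * (\<delta> + \<epsilon> / (2 * \<beta>))"
      using elim(1) \<beta> by (rule mult_strict_left_mono)
    also have "\<dots> = \<beta> * \<delta> + \<epsilon> / 2"
      using \<beta> by (simp add: distrib_left)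
    finally show ?case
      using elim(2) by linarith
  qed
qed

lemma FNP_tendsto:
  assumes bound: "\<forall>y \<in> intervals_from a. 0 \<le> excess y \<longrightarrow> snd y - fst y \<le> \<delta>"
    and approx: "\<forall>\<epsilon>>0. \<exists>u v. 0 \<le> u \<and> u \<le> a \<and> u < v \<and> v \<le> 1 \<and>
      \<beta> * (v - u) < G v - G u \<and> \<delta> - \<epsilon> < v - u"
  shows "(\<lambda>n. FNP n (I n) (p n) (fst (x n)) (snd (x n))) \<longlonglongrightarrow> 1 - \<beta> * \<delta>"
proof -
  have "(\<lambda>n. snd (x n) - fst (x n)) \<longlonglongrightarrow> \<delta>"
  proof (rule order_tendstoI)
    fix l assume "l < \<delta>"
    then obtain u v where uv: "0 \<le> u" "u \<le> a" "u < v" "v \<le> 1" "\<beta> * (v - u) < G v - G u"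
      "\<delta> - (\<delta> - l) < v - u"
      using approx[rule_format, of "\<delta> - l"] by auto
    from width_eventually_ge[OF uv(1-5)] show "\<forall>\<^sub>F n in sequentially. l < snd (x n) - fst (x n)"
      by eventually_elim (use uv(6) in simp)
  next
    fix l assume "\<delta> < l"
    then show "\<forall>\<^sub>F n in sequentially. snd (x n) - fst (x n) < l"
      using width_eventually_less[OF bound, of "l - \<delta>"] by simp
  qed
  then have "(\<lambda>n. 1 - (1 - FNP n (I n) (p n) (fst (x n)) (snd (x n)) - \<beta> * (snd (x n) - fst (x n)))
      - \<beta> * (snd (x n) - fst (x n))) \<longlonglongrightarrow> 1 - 0 - \<beta> * \<delta>"
    by (intro tendsto_intros power_approximation)
  then show ?thesis
    by simp
qed

end

section \<open>Limits of the false non-discovery rates\<close>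

locale testing_model = limit_problem I\<^sub>0 G \<alpha> \<pi>\<^sub>0 + prob_space M
  for I\<^sub>0 :: "nat \<Rightarrow> nat set" and G \<alpha> \<pi>\<^sub>0 and M :: "'a measure" +
  fixes P :: "nat \<Rightarrow> nat \<Rightarrow> 'a \<Rightarrow> real"
  assumes P_measurable: "\<And>n i. i \<in> {1..n} \<Longrightarrow> P n i \<in> borel_measurable M"
    and P_range: "\<And>n i \<omega>. i \<in> {1..n} \<Longrightarrow> \<omega> \<in> space M \<Longrightarrow> P n i \<omega> \<in> {0..1}"
    and V_limit: "\<And>s t. 0 \<le> s \<Longrightarrow> s < t \<Longrightarrow> t \<le> 1 \<Longrightarrow>
      AE \<omega> in M. (\<lambda>n. real (V_count (I\<^sub>0 n) (\<lambda>i. P n i \<omega>) s t) / real (card (I\<^sub>0 n)))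
        \<longlonglongrightarrow> t - s"
    and S_limit: "\<And>s t. 0 \<le> s \<Longrightarrow> s < t \<Longrightarrow> t \<le> 1 \<Longrightarrow>
      AE \<omega> in M. (\<lambda>n. real (S_count n (I\<^sub>0 n) (\<lambda>i. P n i \<omega>) s t)
                       / (real n - real (card (I\<^sub>0 n)))) \<longlonglongrightarrow> G t - G s"
begin

text \<open>
The hypotheses give a null set for each interval; there are countably many grid intervals.
\<close>

lemma AE_regular_sample: "AE \<omega> in M. regular_sample I\<^sub>0 G \<alpha> \<pi>\<^sub>0 (\<lambda>n i. P n i \<omega>)"
proof -
  have grid: "0 \<le> real i / real m" "real i / real m < real j / real m" "real j / real m \<le> 1"
    if "i < j" "j \<le> m" for i j m :: nat
    using that by (auto simp: divide_strict_right_mono)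
  have "AE \<omega> in M. \<forall>i j m. i < j \<longrightarrow> j \<le> m \<longrightarrow>
      (\<lambda>n. real (V_count (I\<^sub>0 n) (\<lambda>i. P n i \<omega>) (real i / real m) (real j / real m))
        / real (card (I\<^sub>0 n))) \<longlonglongrightarrow> real j / real m - real i / real m"
    unfolding AE_all_countable using V_limit[OF grid] by (auto intro!: AE_I2 simp: AE_conj_iff)
  moreover have "AE \<omega> in M. \<forall>i j m. i < j \<longrightarrow> j \<le> m \<longrightarrow>
      (\<lambda>n. real (S_count n (I\<^sub>0 n) (\<lambda>i. P n i \<omega>) (real i / real m) (real j / real m))
        / (real n - real (card (I\<^sub>0 n)))) \<longlonglongrightarrow> G (real j / real m) - G (real i / real m)"
    unfolding AE_all_countable using S_limit[OF grid] by (auto intro!: AE_I2 simp: AE_conj_iff)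
  moreover note AE_space
  ultimately show ?thesis
    by eventually_elim (unfold_locales, use P_range in auto)
qed

text \<open>
The false non-discovery rate of a procedure that rejects the P-values in the random interval
\<open>X n\<close>; both \<open>scan_FNR\<close> and \<open>BH_FNR\<close> are of this form.
\<close>

definition FNR :: "(nat \<Rightarrow> 'a \<Rightarrow> real \<times> real) \<Rightarrow> nat \<Rightarrow> real" where
  "FNR X n = (\<integral>\<omega>. FNP n (I\<^sub>0 n) (\<lambda>i. P n i \<omega>) (fst (X n \<omega>)) (snd (X n \<omega>)) \<partial>M)"

context
  fixes a :: real and X :: "nat \<Rightarrow> 'a \<Rightarrow> real \<times> real"
  assumes a: "0 \<le> a"
    and X: "\<forall>n>0. \<forall>\<omega> \<in> space M.
      leftmost_longest a \<alpha> n (I\<^sub>0 n) (\<lambda>i. P n i \<omega>) (X n \<omega>)"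
begin

lemma FNP_measurable:
  "(\<lambda>\<omega>. FNP n (I\<^sub>0 n) (\<lambda>i. P n i \<omega>) (fst (X n \<omega>)) (snd (X n \<omega>))) \<in> borel_measurable M"
proof (cases "n = 0")
  case True
  then show ?thesis
    unfolding FNP_def S_count_def by simp
next
  case False
  then show ?thesis
    using a \<alpha> nulls P_measurable P_range X
    by (intro FNP_leftmost_longest_measurable[where a = a and \<alpha> = \<alpha>]) auto
qed

lemma AE_selected_intervals:
  "AE \<omega> in M. selected_intervals I\<^sub>0 G \<alpha> \<pi>\<^sub>0 (\<lambda>n i. P n i \<omega>) a (\<lambda>n. X n \<omega>)"
  using AE_regular_sample AE_space
  by eventually_elim
    (auto intro!: selected_intervals.intro selected_intervals_axioms.intro X[rule_format])

lemma FNR_tendsto: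
  assumes "\<forall>y \<in> intervals_from a. 0 \<le> excess y \<longrightarrow> snd y - fst y \<le> \<delta>"
    and "\<forall>\<epsilon>>0. \<exists>u v. 0 \<le> u \<and> u \<le> a \<and> u < v \<and> v \<le> 1 \<and>
      \<beta> * (v - u) < G v - G u \<and> \<delta> - \<epsilon> < v - u"
  shows "FNR X \<longlonglongrightarrow> 1 - \<beta> * \<delta>"
proof -
  have "(\<lambda>n. \<integral>\<omega>. FNP n (I\<^sub>0 n) (\<lambda>i. P n i \<omega>) (fst (X n \<omega>)) (snd (X n \<omega>)) \<partial>M)
      \<longlonglongrightarrow> (\<integral>\<omega>. 1 - \<beta> * \<delta> \<partial>M)"
  proof (rule integral_dominated_convergence[where w = "\<lambda>_. 1"])
    show "AE \<omega> in M. (\<lambda>n. FNP n (I\<^sub>0 n) (\<lambda>i. P n i \<omega>) (fst (X n \<omega>)) (snd (X n \<omega>)))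
        \<longlonglongrightarrow> 1 - \<beta> * \<delta>"
      using AE_selected_intervals
      by eventually_elim (rule selected_intervals.FNP_tendsto[OF _ assms])
  qed (auto intro!: FNP_measurable AE_I2 simp: abs_le_iff FNP_bounds order_trans[OF _ FNP_bounds(1)])
  then show ?thesis
    unfolding FNR_def[abs_def] by (simp add: prob_space)
qed

text \<open>
If the limiting BH constraint is only touched, not strictly satisfied, near \<open>BH_limit\<close>, the random
threshold may keep falling short of it, and its rate need not converge.  But falling short only
costs power, and a bound from below on the rate remains.  Capping the proportion at the
bound makes it converge almost surely, so dominated convergence applies.
\<close>

lemma liminf_FNR_ge:
  assumes "\<forall>y \<in> intervals_from a. 0 \<le> excess y \<longrightarrow> snd y - fst y \<le> \<delta>"
  shows "ereal (1 - \<beta> * \<delta>) \<le> liminf (\<lambda>n. ereal (FNR X n))"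
proof -
  let ?F = "\<lambda>n \<omega>. FNP n (I\<^sub>0 n) (\<lambda>i. P n i \<omega>) (fst (X n \<omega>)) (snd (X n \<omega>))"
  let ?c = "1 - \<beta> * \<delta>"
  have bound: "\<bar>?F n \<omega>\<bar> \<le> 1" for n \<omega>
    using FNP_bounds[of n "\<lambda>i. P n i \<omega>" "fst (X n \<omega>)" "snd (X n \<omega>)"] by (simp add: abs_le_iff)
  note [measurable] = FNP_measurable
  have "(\<lambda>n. \<integral>\<omega>. min (?F n \<omega>) ?c \<partial>M) \<longlonglongrightarrow> (\<integral>\<omega>. ?c \<partial>M)"
  proof (rule integral_dominated_convergence[where w = "\<lambda>_. 1 + \<bar>?c\<bar>"])
    show "AE \<omega> in M. (\<lambda>n. min (?F n \<omega>) ?c) \<longlonglongrightarrow> ?c"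
      using AE_selected_intervals
    proof eventually_elim
      case (elim \<omega>)
      show ?case
      proof (rule order_tendstoI)
        fix l assume "l < ?c"
        then show "\<forall>\<^sub>F n in sequentially. l < min (?F n \<omega>) ?c"
          using selected_intervals.FNP_eventually_greater[OF elim assms, of "?c - l"] by simp
      next
        fix l assume "?c < l"
        then show "\<forall>\<^sub>F n in sequentially. min (?F n \<omega>) ?c < l"
          by (simp add: min_less_iff_disj)
      qed
    qed
    show "AE \<omega> in M. norm (min (?F n \<omega>) ?c) \<le> 1 + \<bar>?c\<bar>" for n
      using bound[of n] by (intro AE_I2) (smt (verit) real_norm_def)
  qed auto
  then have "(\<lambda>n. \<integral>\<omega>. min (?F n \<omega>) ?c \<partial>M) \<longlonglongrightarrow> ?c"
    by (simp add: prob_space)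
  then have "ereal ?c = liminf (\<lambda>n. ereal (\<integral>\<omega>. min (?F n \<omega>) ?c \<partial>M))"
    by (intro lim_imp_Liminf[symmetric]) auto
  also have "\<dots> \<le> liminf (\<lambda>n. ereal (FNR X n))"
  proof (intro Liminf_mono always_eventually allI)
    fix n
    have int: "integrable M (?F n)"
      by (rule integrable_const_bound[where B = 1]) (use bound in auto)
    then have "(\<integral>\<omega>. min (?F n \<omega>) ?c \<partial>M) \<le> (\<integral>\<omega>. ?F n \<omega> \<partial>M)"
      by (intro integral_mono integrable_min) auto
    then show "ereal (\<integral>\<omega>. min (?F n \<omega>) ?c \<partial>M) \<le> ereal (FNR X n)"
      unfolding FNR_def by simp
  qed
  finally show ?thesis .
qed

end

end

theorem theorem5:
  fixes M :: "'a measure"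
    and P :: "nat \<Rightarrow> nat \<Rightarrow> 'a \<Rightarrow> real"
    and I\<^sub>0 :: "nat \<Rightarrow> nat set"
    and G G' :: "real \<Rightarrow> real"
    and \<alpha> \<pi>\<^sub>0 :: real
  assumes "prob_space M"
    and "0 < \<alpha>" and "\<alpha> < 1"
    and "\<And>n. I\<^sub>0 n \<subseteq> {1..n}"
    and "\<And>n. prob_space.indep_vars M (\<lambda>_. borel) (P n) {1..n}"
    and "\<And>n i \<omega>. i \<in> {1..n} \<Longrightarrow> \<omega> \<in> space M \<Longrightarrow> P n i \<omega> \<in> {0..1}"
    and "(\<lambda>n. real (card (I\<^sub>0 n)) / real n) \<longlonglongrightarrow> \<pi>\<^sub>0"
    and "0 < \<pi>\<^sub>0" and "\<pi>\<^sub>0 < 1"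
    and "mono G" and "continuous_on UNIV G"
    and "(G \<longlongrightarrow> 0) at_bot" and "(G \<longlongrightarrow> 1) at_top"
    and "\<And>s t. 0 \<le> s \<Longrightarrow> s < t \<Longrightarrow> t \<le> 1 \<Longrightarrow>
           AE \<omega> in M. (\<lambda>n. real (V_count (I\<^sub>0 n) (\<lambda>i. P n i \<omega>) s t) / real (card (I\<^sub>0 n)))
             \<longlonglongrightarrow> t - s"
    and "\<And>s t. 0 \<le> s \<Longrightarrow> s < t \<Longrightarrow> t \<le> 1 \<Longrightarrow>
           AE \<omega> in M. (\<lambda>n. real (S_count n (I\<^sub>0 n) (\<lambda>i. P n i \<omega>) s t)
                              / (real n - real (card (I\<^sub>0 n))))
             \<longlonglongrightarrow> G t - G s"
    and "\<And>x. x \<in> {0..1} \<Longrightarrow> (G has_real_derivative G' x) (at x within {0..1})"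
    and "opt_width \<alpha> \<pi>\<^sub>0 G > 0"
    and "\<exists>(s, t) \<in> opt_intervals \<alpha> \<pi>\<^sub>0 G.
           strictly_decreasing_at (\<lambda>u. FDR_inf \<pi>\<^sub>0 G u t) s \<or>
           strictly_increasing_at (\<lambda>u. FDR_inf \<pi>\<^sub>0 G s u) t"
    and "G' 0 < G' (BH_limit \<alpha> \<pi>\<^sub>0 G)"
  shows "convergent (scan_FNR M \<alpha> I\<^sub>0 P)
    \<and> (convergent (BH_FNR M \<alpha> I\<^sub>0 P) \<longrightarrow> lim (scan_FNR M \<alpha> I\<^sub>0 P) < lim (BH_FNR M \<alpha> I\<^sub>0 P))
    \<and> ereal (lim (scan_FNR M \<alpha> I\<^sub>0 P)) < liminf (\<lambda>n. ereal (BH_FNR M \<alpha> I\<^sub>0 P n))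
    \<and> (BH_limit \<alpha> \<pi>\<^sub>0 G \<in> closure {t \<in> {0<..1}. FDR_inf \<pi>\<^sub>0 G 0 t < \<alpha>}
         \<longrightarrow> convergent (BH_FNR M \<alpha> I\<^sub>0 P))"
proof -
  interpret prob_space M by fact
  have P_measurable: "P n i \<in> borel_measurable M" if "i \<in> {1..n}" for n i
    using assms(5)[of n] that unfolding indep_vars_def2 by auto
  interpret testing_model I\<^sub>0 G \<alpha> \<pi>\<^sub>0 M P
    by unfold_locales (use assms P_measurable in auto)
  let ?\<delta> = "opt_width \<alpha> \<pi>\<^sub>0 G" and ?\<delta>\<^sub>0 = "BH_limit \<alpha> \<pi>\<^sub>0 G"

  let ?scan = "\<lambda>n \<omega>. scan_interval \<alpha> n (I\<^sub>0 n) (\<lambda>i. P n i \<omega>)"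
  let ?BH = "\<lambda>n \<omega>. (0 :: real, BH_threshold \<alpha> n (I\<^sub>0 n) (\<lambda>i. P n i \<omega>))"
  have selection: "\<exists>x. leftmost_longest a \<alpha> n (I\<^sub>0 n) (\<lambda>i. P n i \<omega>) x"
    if "0 \<le> a" "0 < n" "\<omega> \<in> space M" for a n \<omega>
    using that \<alpha> nulls P_range by (intro leftmost_longest_exists) auto
  have scan: "\<forall>n>0. \<forall>\<omega> \<in> space M. leftmost_longest 1 \<alpha> n (I\<^sub>0 n) (\<lambda>i. P n i \<omega>) (?scan n \<omega>)"
    using selection[OF zero_le_one] scan_interval_eqI by metis
  have BH: "\<forall>n>0. \<forall>\<omega> \<in> space M. leftmost_longest 0 \<alpha> n (I\<^sub>0 n) (\<lambda>i. P n i \<omega>) (?BH n \<omega>)"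
    using selection[OF order_refl] BH_threshold_eqI by metis
  have scan_FNR: "scan_FNR M \<alpha> I\<^sub>0 P = FNR ?scan"
    unfolding scan_FNR_def FNR_def Let_def by (simp add: fun_eq_iff case_prod_unfold)
  have BH_FNR: "BH_FNR M \<alpha> I\<^sub>0 P = FNR ?BH"
    unfolding BH_FNR_def FNR_def Let_def by (simp add: fun_eq_iff)

  have scan_bound: "\<forall>y \<in> intervals_from 1. 0 \<le> excess y \<longrightarrow> snd y - fst y \<le> ?\<delta>"
    using width_le_opt_width[OF \<alpha>(1) \<pi>\<^sub>0 mono_G cont_G] by simp
  have BH_bound: "\<forall>y \<in> intervals_from 0. 0 \<le> excess y \<longrightarrow> snd y - fst y \<le> ?\<delta>\<^sub>0"
    using BH_limit_greatest(4)[OF \<alpha>(1) \<pi>\<^sub>0 mono_G cont_G]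
    by (auto simp: intervals_from_def)

  have scan_limit: "FNR ?scan \<longlonglongrightarrow> 1 - \<beta> * ?\<delta>"
  proof (rule FNR_tendsto[OF zero_le_one scan scan_bound], intro allI impI)
    fix \<epsilon> :: real assume "0 < \<epsilon>"
    then show "\<exists>u v. 0 \<le> u \<and> u \<le> 1 \<and> u < v \<and> v \<le> 1 \<and>
        \<beta> * (v - u) < G v - G u \<and> ?\<delta> - \<epsilon> < v - u"
      using strictly_feasible_near_opt_width[OF \<alpha>(1) \<pi>\<^sub>0 mono_G assms(17)] assms(18) by blast
  qed

  have BH_limit: "FNR ?BH \<longlonglongrightarrow> 1 - \<beta> * ?\<delta>\<^sub>0"
    if closure: "?\<delta>\<^sub>0 \<in> closure {t \<in> {0<..1}. FDR_inf \<pi>\<^sub>0 G 0 t < \<alpha>}"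
  proof (rule FNR_tendsto[OF order_refl BH BH_bound], intro allI impI)
    fix \<epsilon> :: real assume "0 < \<epsilon>"
    then obtain t where t: "0 < t" "t \<le> 1" "FDR_inf \<pi>\<^sub>0 G 0 t < \<alpha>" "dist t ?\<delta>\<^sub>0 < \<epsilon>"
      using closure unfolding closure_approachable by auto
    then have "\<beta> * (t - 0) < G t - G 0"
      using FDR_inf_level_iff(2)[OF \<alpha>(1) \<pi>\<^sub>0 mono_G, of 0 t] by simp
    then show "\<exists>u v. 0 \<le> u \<and> u \<le> 0 \<and> u < v \<and> v \<le> 1 \<and>
        \<beta> * (v - u) < G v - G u \<and> ?\<delta>\<^sub>0 - \<epsilon> < v - u"
      using t by (intro exI[of _ 0] exI[of _ t]) (auto simp: dist_real_def)
  qed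

  have "G x \<le> 1" for x
    using assms(13) by (rule tendsto_lowerbound)
      (auto intro!: eventually_at_top_linorderI[of x] monoD[OF mono_G])
  moreover have "0 \<le> G x" for x
    using assms(12) by (rule tendsto_upperbound)
      (auto intro!: eventually_at_bot_linorderI[of x] monoD[OF mono_G])
  ultimately have "G 1 - G 0 \<le> 1"
    by (smt (verit))
  then have "?\<delta>\<^sub>0 < ?\<delta>"
    using BH_limit_less_opt_width[OF \<alpha> \<pi>\<^sub>0 mono_G cont_G _ assms(16,19)] by simp
  then have "1 - \<beta> * ?\<delta> < 1 - \<beta> * ?\<delta>\<^sub>0"
    using critical_slope_gt_1[OF \<alpha> \<pi>\<^sub>0(2)] by simp
  then have "ereal (1 - \<beta> * ?\<delta>) < ereal (1 - \<beta> * ?\<delta>\<^sub>0)"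
    by simp
  also have "\<dots> \<le> liminf (\<lambda>n. ereal (FNR ?BH n))"
    by (rule liminf_FNR_ge[OF order_refl BH BH_bound])
  finally have less: "ereal (lim (FNR ?scan)) < liminf (\<lambda>n. ereal (FNR ?BH n))"
    using scan_limit by (simp add: limI)
  have "lim (FNR ?scan) < lim (FNR ?BH)" if "convergent (FNR ?BH)"
  proof -
    have "(\<lambda>n. ereal (FNR ?BH n)) \<longlonglongrightarrow> ereal (lim (FNR ?BH))"
      using that by (simp add: convergent_LIMSEQ_iff)
    then have "liminf (\<lambda>n. ereal (FNR ?BH n)) = ereal (lim (FNR ?BH))"
      by (intro lim_imp_Liminf) auto
    then show ?thesis
      using less by simp
  qed
  then show ?thesis
    unfolding scan_FNR BH_FNR using less scan_limit BH_limit convergentI by blast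
qed

end
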